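(* Let $S$ be a Noetherian domain which is an analytically unramified local ring, and let $\mathfrak{a}_\bullet$ and $\mathfrak{b}_\bullet$ be filtrations of nonzero ideals in $S$. Suppose that $\mathcal{R}^{[k]}(\mathfrak{a}_\bullet)$ and $\mathcal{R}^{[\ell]}(\mathfrak{b}_\bullet)$ are standard graded $S$-algebras for some $k,\ell\in\mathbb{N}$, and that $\mathcal{R}(\overline{\mathfrak{b}_\bullet})$ is a finitely generated $\mathcal{R}(\mathfrak{b}_\bullet)$-module. Suppose further that $\mathfrak{b}_\bullet$ is $\mathfrak{b}$-equivalent for some ideal $\mathfrak{b}\subseteq S$. Then $\rho(\mathfrak{a}_\bullet,\mathfrak{b}_\bullet)$ is either infinite (i.e. $\pm\infty$) or a rational number.
   Context: $\mathbb{N}$ denotes the positive integers. A Noetherian local ring $(S,\mathfrak{m})$ is analytically unramified if its $\mathfrak{m}$-adic completion is reduced. A filtration of ideals in $S$ is a collection $\mathfrak{a}_\bullet=\{\mathfrak{a}_i\}_{i\ge 1}$ of ideals with $\mathfrak{a}_p\mathfrak{a}_q\subseteq\mathfrak{a}_{p+q}$ and $\mathfrak{a}_p\supseteq\mathfrak{a}_{p+1}$ for all $p,q\ge 1$ (convention: $\mathfrak{a}_0=S$). $\overline{\mathfrak{b}_\bullet}=\{\overline{\mathfrak{b}_i}\}_{i\ge1}$ is the family of integral closures. The Rees algebra is $\mathcal{R}(\mathfrak{a}_\bullet)=\bigoplus_{n\ge0}\mathfrak{a}_nt^n\subseteq S[t]$, and its $k$-th Veronese subalgebra is $\mathcal{R}^{[k]}(\mathfrak{a}_\bullet)=\bigoplus_{n\ge0}\mathfrak{a}_{kn}t^{kn}$;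 the latter is standard graded if generated over $S$ by $\mathfrak{a}_kt^k$, i.e. $\mathfrak{a}_{kn}=\mathfrak{a}_k^n$ for all $n\ge1$. $\mathfrak{b}_\bullet$ is $\mathfrak{b}$-equivalent, for an ideal $\mathfrak{b}\subseteq S$, if there is a positive integer $m$ such that $\mathfrak{b}_{i+m}\subseteq\mathfrak{b}^i\subseteq\mathfrak{b}_i$ for all $i\ge1$. The resurgence number is $$\rho(\mathfrak{a}_\bullet,\mathfrak{b}_\bullet)=\sup\left\{\tfrac{s}{r}\mid s,r\in\mathbb{N},\ \mathfrak{a}_s\not\subseteq\mathfrak{b}_r\right\},$$ with values in the extended reals and $\sup\varnothing=-\infty$. *)

theory Defs
  imports
    "HOL-Computational_Algebra.Polynomial"
    "HOL-Library.Extended_Real"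
    "HOL-Algebra.Ring"
begin

section \<open>Ideals\<close>

text \<open>
  The ambient ring is a type of class \<open>comm_ring_1\<close> (later \<open>idom\<close>), viewed as a module over
  itself: ideals are its submodules.
\<close>

lemma module_self: "Modules.module ((*) :: 'a::comm_ring_1 \<Rightarrow> 'a \<Rightarrow> 'a)"
  by standard (simp_all add: algebra_simps)

definition is_ideal :: "'a::comm_ring_1 set \<Rightarrow> bool" where
  "is_ideal I \<longleftrightarrow> Modules.module.subspace (*) I"

definition ideal_gen :: "'a::comm_ring_1 set \<Rightarrow> 'a set" where
  "ideal_gen X = Modules.module.span (*) X"

definition ideal_mult :: "'a::comm_ring_1 set \<Rightarrow> 'a set \<Rightarrow> 'a set" where
  "ideal_mult I J = ideal_gen {x * y |x y. x \<in> I \<and> y \<in> J}"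

primrec ideal_power :: "'a::comm_ring_1 set \<Rightarrow> nat \<Rightarrow> 'a set" where
  "ideal_power I 0 = UNIV"
| "ideal_power I (Suc n) = ideal_mult I (ideal_power I n)"

definition integral_closure :: "'a::comm_ring_1 set \<Rightarrow> 'a set" where
  "integral_closure I =
     {x. \<exists>n\<ge>1. \<exists>c. (\<forall>i\<in>{1..n}. c i \<in> ideal_power I i) \<and>
           x ^ n + (\<Sum>i=1..n. c i * x ^ (n - i)) = 0}"

definition maximal_ideal_of_ring :: "'a::comm_ring_1 set \<Rightarrow> bool" where
  "maximal_ideal_of_ring M \<longleftrightarrow>
     is_ideal M \<and> M \<noteq> UNIV \<and> (\<forall>J. is_ideal J \<and> M \<subseteq> J \<longrightarrow> J = M \<or> J = UNIV)"

text \<open>The type \<open>'a\<close> is a Noetherian local ring and \<open>M\<close> is its unique maximal ideal.\<close>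

definition noetherian_local :: "'a::comm_ring_1 set \<Rightarrow> bool" where
  "noetherian_local M \<longleftrightarrow>
     (\<forall>I::'a set. is_ideal I \<longrightarrow> (\<exists>G. finite G \<and> I = ideal_gen G)) \<and>
     (\<forall>J. maximal_ideal_of_ring J \<longleftrightarrow> J = M)"

lemma is_ideal_iff:
  "is_ideal I \<longleftrightarrow> 0 \<in> I \<and> (\<forall>x\<in>I. \<forall>y\<in>I. x + y \<in> I) \<and> (\<forall>c. \<forall>x\<in>I. c * x \<in> I)"
proof -
  interpret M: Modules.module "(*) :: 'a \<Rightarrow> 'a \<Rightarrow> 'a" by (rule module_self)
  show ?thesis unfolding is_ideal_def M.subspace_def by blast
qed

lemma ideal_0: "is_ideal I \<Longrightarrow> 0 \<in> I"
  and ideal_add: "is_ideal I \<Longrightarrow> x \<in> I \<Longrightarrow> y \<in> I \<Longrightarrow> x + y \<in> I"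
  and ideal_scale: "is_ideal I \<Longrightarrow> x \<in> I \<Longrightarrow> c * x \<in> I"
  by (simp_all add: is_ideal_iff)

lemma ideal_sum: "is_ideal I \<Longrightarrow> (\<And>i. i \<in> A \<Longrightarrow> f i \<in> I) \<Longrightarrow> sum f A \<in> I"
  by (induction A rule: infinite_finite_induct) (auto intro: ideal_0 ideal_add)

lemma is_ideal_gen: "is_ideal (ideal_gen X)"
proof -
  interpret M: Modules.module "(*) :: 'a \<Rightarrow> 'a \<Rightarrow> 'a" by (rule module_self)
  show ?thesis unfolding is_ideal_def ideal_gen_def by (rule M.subspace_span)
qed

lemma ideal_gen_superset: "X \<subseteq> ideal_gen X"
proof -
  interpret M: Modules.module "(*) :: 'a \<Rightarrow> 'a \<Rightarrow> 'a" by (rule module_self)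
  show ?thesis unfolding ideal_gen_def by (rule M.span_superset)
qed

lemma ideal_gen_minimal: "X \<subseteq> I \<Longrightarrow> is_ideal I \<Longrightarrow> ideal_gen X \<subseteq> I"
proof -
  interpret M: Modules.module "(*) :: 'a \<Rightarrow> 'a \<Rightarrow> 'a" by (rule module_self)
  show "X \<subseteq> I \<Longrightarrow> is_ideal I \<Longrightarrow> ideal_gen X \<subseteq> I"
    unfolding ideal_gen_def is_ideal_def by (rule M.span_minimal)
qed

lemma is_ideal_power: "is_ideal (ideal_power I n)"
  by (cases n) (simp_all add: is_ideal_gen ideal_mult_def, simp add: is_ideal_iff)

lemma ideal_power_Suc_subset: "ideal_power I (Suc n) \<subseteq> ideal_power I n"
  unfolding ideal_power.simps ideal_mult_def
  by (rule ideal_gen_minimal[OF _ is_ideal_power])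
     (use is_ideal_power[of I n] in \<open>auto simp: is_ideal_iff\<close>)


section \<open>Adic completion\<close>

definition coset :: "'a::comm_ring_1 set \<Rightarrow> 'a \<Rightarrow> 'a set" where
  "coset J x = {x + z |z. z \<in> J}"

text \<open>
  The completion is the inverse limit of the quotients of the ring by the powers of \<open>I\<close>. An element
  is a sequence \<open>c\<close> in which \<open>c n\<close> is a coset of \<open>ideal_power I n\<close>; for such cosets, \<open>c (n + 1)\<close>
  is mapped to \<open>c n\<close> by the transition map iff \<open>c (n + 1)\<close> is a subset of \<open>c n\<close>.
\<close>

definition adic_completion :: "'a::comm_ring_1 set \<Rightarrow> (nat \<Rightarrow> 'a set) ring" where
  "adic_completion I =
     \<lparr> carrier = {c. \<forall>n. c n \<in> range (coset (ideal_power I n)) \<and> c (Suc n) \<subseteq> c n},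
       monoid.mult = (\<lambda>c d n. {x * y + z |x y z. x \<in> c n \<and> y \<in> d n \<and> z \<in> ideal_power I n}),
       one = (\<lambda>n. coset (ideal_power I n) 1),
       zero = (\<lambda>n. ideal_power I n),
       add = (\<lambda>c d n. {x + y |x y. x \<in> c n \<and> y \<in> d n}) \<rparr>"

definition reduced_ring :: "('b, 'c) ring_scheme \<Rightarrow> bool" where
  "reduced_ring R \<longleftrightarrow>
     (\<forall>x\<in>carrier R. \<forall>n::nat. x [^]\<^bsub>R\<^esub> n = \<zero>\<^bsub>R\<^esub> \<longrightarrow> x = \<zero>\<^bsub>R\<^esub>)"

definition analytically_unramified_local :: "'a::comm_ring_1 set \<Rightarrow> bool" where
  "analytically_unramified_local M \<longleftrightarrow>
     noetherian_local M \<and> reduced_ring (adic_completion M)"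

lemma coset_self: "is_ideal J \<Longrightarrow> x \<in> coset J x"
  by (force simp: coset_def is_ideal_iff)

lemma is_ideal_uminus: "is_ideal J \<Longrightarrow> x \<in> J \<Longrightarrow> - x \<in> J"
  using is_ideal_iff[of J] mult_minus1[of x] by metis

lemma is_ideal_diff: "is_ideal J \<Longrightarrow> x \<in> J \<Longrightarrow> y \<in> J \<Longrightarrow> x - y \<in> J"
  using is_ideal_iff[of J] is_ideal_uminus[of J y] by (metis diff_conv_add_uminus)

lemma mem_coset_iff: "y \<in> coset J x \<longleftrightarrow> y - x \<in> J"
  by (force simp: coset_def)

lemma coset_eq_iff:
  assumes "is_ideal J" shows "coset J x = coset J y \<longleftrightarrow> x - y \<in> J"
proof
  assume "coset J x = coset J y"
  then show "x - y \<in> J" using coset_self[OF assms, of x] by (simp add: mem_coset_iff)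
next
  assume *: "x - y \<in> J"
  have "u - x \<in> J \<longleftrightarrow> u - y \<in> J" for u
    using is_ideal_diff[OF assms, of "u - y" "x - y"] * assms[unfolded is_ideal_iff]
    by (metis diff_add_cancel add_diff_eq diff_diff_eq2)
  then show "coset J x = coset J y" by (auto simp: mem_coset_iff)
qed

lemma coset_mult:
  assumes "is_ideal J"
  shows "{u * v + z |u v z. u \<in> coset J x \<and> v \<in> coset J y \<and> z \<in> J} = coset J (x * y)"
    (is "?L = ?R")
proof
  show "?R \<subseteq> ?L" using coset_self[OF assms] by (fastforce simp: coset_def)
  show "?L \<subseteq> ?R"
  proof
    fix w assume "w \<in> ?L"
    then obtain p q z where w: "w = (x + p) * (y + q) + z" "p \<in> J" "q \<in> J" "z \<in> J"
      by (auto simp: coset_def)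
    have "w - x * y = (x + p) * q + (y * p + z)" unfolding w(1) by (simp add: algebra_simps)
    also have "\<dots> \<in> J" by (intro ideal_add[OF assms] ideal_scale[OF assms] w)
    finally show "w \<in> ?R" by (simp add: mem_coset_iff)
  qed
qed

lemma coset_add:
  assumes "is_ideal J"
  shows "{u + v |u v. u \<in> coset J x \<and> v \<in> coset J y} = coset J (x + y)" (is "?L = ?R")
proof
  show "?R \<subseteq> ?L" 
  proof
    fix w assume "w \<in> ?R"
    then have "w - y \<in> coset J x" by (simp add: mem_coset_iff algebra_simps)
    then show "w \<in> ?L" using coset_self[OF assms, of y] by force
  qed
  show "?L \<subseteq> ?R"
  proof
    fix w assume "w \<in> ?L"
    then obtain p q where w: "w = (x + p) + (y + q)" "p \<in> J" "q \<in> J"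
      by (auto simp: coset_def)
    then show "w \<in> ?R" using assms by (simp add: mem_coset_iff is_ideal_iff)
  qed
qed

lemma coset_zero: "coset J 0 = J"
  by (auto simp: coset_def)

lemma coset_subset_iff:
  assumes "is_ideal J" "is_ideal K" "K \<subseteq> J"
  shows "coset K x \<subseteq> coset J y \<longleftrightarrow> x - y \<in> J"
proof
  assume "coset K x \<subseteq> coset J y"
  then show "x - y \<in> J" using coset_self[OF assms(2), of x] mem_coset_iff by blast
next
  assume "x - y \<in> J"
  then have "coset J x = coset J y" using coset_eq_iff[OF assms(1)] by blast
  moreover have "coset K x \<subseteq> coset J x" using assms(3) by (auto simp: coset_def)
  ultimately show "coset K x \<subseteq> coset J y" by simp
qed

lemma carrier_adic_completion:
  "c \<in> carrier (adic_completion I) \<longleftrightarrow>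
     (\<exists>x. c = (\<lambda>n. coset (ideal_power I n) (x n)) \<and> (\<forall>n. x (Suc n) - x n \<in> ideal_power I n))"
proof -
  have "c \<in> carrier (adic_completion I) \<longleftrightarrow>
     (\<exists>x. \<forall>n. c n = coset (ideal_power I n) (x n)) \<and> (\<forall>n. c (Suc n) \<subseteq> c n)"
    by (auto simp: adic_completion_def image_iff intro: choice)
  also have "\<dots> \<longleftrightarrow> (\<exists>x. c = (\<lambda>n. coset (ideal_power I n) (x n)) \<and> (\<forall>n. c (Suc n) \<subseteq> c n))"
    by (auto simp: fun_eq_iff)
  also have "\<dots> \<longleftrightarrow> (\<exists>x. c = (\<lambda>n. coset (ideal_power I n) (x n)) \<and>
       (\<forall>n. x (Suc n) - x n \<in> ideal_power I n))"
  proof -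
    have "coset (ideal_power I (Suc n)) (x (Suc n)) \<subseteq> coset (ideal_power I n) (x n) \<longleftrightarrow>
            x (Suc n) - x n \<in> ideal_power I n" for x :: "nat \<Rightarrow> 'a" and n
      by (rule coset_subset_iff[OF is_ideal_power is_ideal_power ideal_power_Suc_subset])
    then show ?thesis by (intro ex_cong1 conj_cong refl) (simp del: ideal_power.simps)
  qed
  finally show ?thesis .
qed

lemma adic_completion_cring: "cring (adic_completion I)"
proof -
  let ?C = "adic_completion I"
  let ?P = "ideal_power I"
  define q where "q x = (\<lambda>n. coset (?P n) (x n))" for x
  define A where "A = {x. \<forall>n. x (Suc n) - x n \<in> ?P n}"
  have car: "carrier ?C = q ` A"
    using carrier_adic_completion[of _ I] by (auto simp: q_def A_def)
  have m: "q x \<otimes>\<^bsub>?C\<^esub> q y = q (\<lambda>n. x n * y n)" for x y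
    by (simp add: adic_completion_def q_def coset_mult is_ideal_power)
  have a: "q x \<oplus>\<^bsub>?C\<^esub> q y = q (\<lambda>n. x n + y n)" for x y
    by (simp add: adic_completion_def q_def coset_add is_ideal_power)
  have one: "\<one>\<^bsub>?C\<^esub> = q (\<lambda>_. 1)" and zero: "\<zero>\<^bsub>?C\<^esub> = q (\<lambda>_. 0)"
    by (simp_all add: adic_completion_def q_def coset_zero)
  have A0: "(\<lambda>_. 0) \<in> A" and A1: "(\<lambda>_. 1) \<in> A"
    using is_ideal_power[of I] by (auto simp: A_def is_ideal_iff)
  have Aa: "(\<lambda>n. x n + y n) \<in> A" if "x \<in> A" "y \<in> A" for x y
  proof -
    have "x (Suc n) + y (Suc n) - (x n + y n) \<in> ?P n" for n
    proof -
      have "x (Suc n) + y (Suc n) - (x n + y n) = (x (Suc n) - x n) + (y (Suc n) - y n)"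
        by (simp add: algebra_simps)
      also have "\<dots> \<in> ?P n"
        using that by (intro ideal_add[OF is_ideal_power]) (auto simp: A_def)
      finally show ?thesis .
    qed
    then show ?thesis by (simp add: A_def)
  qed
  have Am: "(\<lambda>n. x n * y n) \<in> A" if "x \<in> A" "y \<in> A" for x y
  proof -
    have "x (Suc n) * y (Suc n) - (x n * y n) \<in> ?P n" for n
    proof -
      have "x (Suc n) * y (Suc n) - (x n * y n) =
              y (Suc n) * (x (Suc n) - x n) + x n * (y (Suc n) - y n)"
        by (simp add: algebra_simps)
      also have "\<dots> \<in> ?P n"
        using that
        by (intro ideal_add[OF is_ideal_power] ideal_scale[OF is_ideal_power]) (auto simp: A_def)
      finally show ?thesis .
    qed
    then show ?thesis by (simp add: A_def)
  qed
  have An: "(\<lambda>n. - x n) \<in> A" if "x \<in> A" for x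
  proof -
    have "- x (Suc n) - (- x n) \<in> ?P n" for n
      using that is_ideal_uminus[OF is_ideal_power, of "x (Suc n) - x n" I n]
      by (simp add: A_def)
    then show ?thesis by (simp add: A_def)
  qed
  show ?thesis
  proof (rule cringI)
    show "abelian_group ?C"
    proof (rule abelian_groupI)
      fix c assume "c \<in> carrier ?C"
      then obtain x where "x \<in> A" "c = q x" by (auto simp: car)
      then show "\<exists>d\<in>carrier ?C. d \<oplus>\<^bsub>?C\<^esub> c = \<zero>\<^bsub>?C\<^esub>"
        using An by (intro bexI[of _ "q (\<lambda>n. - x n)"]) (auto simp: car a zero)
    qed (use Aa A0 in \<open>auto simp: car a zero add_ac\<close>)
    show "comm_monoid ?C"
      by (rule comm_monoidI) (use Am A1 in \<open>auto simp: car m one mult_ac\<close>)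
  qed (auto simp: car m a distrib_right)
qed


section \<open>Filtrations, Rees algebras and Veronese subalgebras\<close>

text \<open>
  A filtration is indexed by all natural numbers, the value at \<open>0\<close> being the whole ring.
\<close>

definition ideal_filtration :: "(nat \<Rightarrow> 'a::comm_ring_1 set) \<Rightarrow> bool" where
  "ideal_filtration a \<longleftrightarrow>
     a 0 = UNIV \<and> (\<forall>i\<ge>1. is_ideal (a i)) \<and>
     (\<forall>p\<ge>1. \<forall>q\<ge>1. ideal_mult (a p) (a q) \<subseteq> a (p + q)) \<and>
     (\<forall>p\<ge>1. a (p + 1) \<subseteq> a p)"

definition rees_algebra :: "(nat \<Rightarrow> 'a::comm_ring_1 set) \<Rightarrow> 'a poly set" where
  "rees_algebra a = {p. \<forall>n. coeff p n \<in> a n}"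

definition veronese :: "nat \<Rightarrow> (nat \<Rightarrow> 'a::comm_ring_1 set) \<Rightarrow> 'a poly set" where
  "veronese k a = {p \<in> rees_algebra a. \<forall>n. \<not> k dvd n \<longrightarrow> coeff p n = 0}"

inductive_set subalgebra_gen :: "'a::comm_ring_1 poly set \<Rightarrow> 'a poly set"
  for X :: "'a poly set" where
  const: "[:c:] \<in> subalgebra_gen X"
| gen: "p \<in> X \<Longrightarrow> p \<in> subalgebra_gen X"
| add: "p \<in> subalgebra_gen X \<Longrightarrow> q \<in> subalgebra_gen X \<Longrightarrow> p + q \<in> subalgebra_gen X"
| mult: "p \<in> subalgebra_gen X \<Longrightarrow> q \<in> subalgebra_gen X \<Longrightarrow> p * q \<in> subalgebra_gen X"

text \<open>
  The usual reformulation in terms of powers of \<open>a k\<close> is \<open>standard_graded_veronese_iff\<close> below.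
\<close>

definition standard_graded_veronese :: "nat \<Rightarrow> (nat \<Rightarrow> 'a::comm_ring_1 set) \<Rightarrow> bool" where
  "standard_graded_veronese k a \<longleftrightarrow>
     veronese k a = subalgebra_gen {monom c k |c. c \<in> a k}"

lemma ideal_mult_memI: "x \<in> I \<Longrightarrow> y \<in> J \<Longrightarrow> x * y \<in> ideal_mult I J"
  using ideal_gen_superset[of "{x * y |x y. x \<in> I \<and> y \<in> J}"] by (auto simp: ideal_mult_def)

lemma ideal_power_mult:
  assumes "x \<in> ideal_power I i" "y \<in> ideal_power I j"
  shows "x * y \<in> ideal_power I (i + j)"
  using assms
proof (induction i arbitrary: x)
  case 0
  then show ?case by (simp add: ideal_scale is_ideal_power)
next
  case (Suc i)
  let ?K = "{x. x * y \<in> ideal_power I (Suc i + j)}"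
  have "is_ideal ?K"
    using is_ideal_power[of I "Suc i + j"]
    by (auto simp: is_ideal_iff distrib_right mult.assoc simp del: ideal_power.simps)
  moreover have "{u * v |u v. u \<in> I \<and> v \<in> ideal_power I i} \<subseteq> ?K"
  proof clarify
    fix u v assume "u \<in> I" "v \<in> ideal_power I i"
    then have "u * (v * y) \<in> ideal_mult I (ideal_power I (i + j))"
      using Suc by (intro ideal_mult_memI)
    then show "(u * v) * y \<in> ideal_power I (Suc i + j)" by (simp add: mult.assoc)
  qed
  ultimately have "ideal_power I (Suc i) \<subseteq> ?K"
    by (simp only: ideal_power.simps ideal_mult_def ideal_gen_minimal)
  then show ?case using Suc.prems by blast
qed

lemma subalgebra_gen_monom:
  assumes "k \<ge> 1"
  shows "subalgebra_gen {monom c k |c. c \<in> J} =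
    {p. \<forall>n. (k dvd n \<longrightarrow> coeff p n \<in> ideal_power J (n div k)) \<and> (\<not> k dvd n \<longrightarrow> coeff p n = 0)}"
    (is "?L = ?R")
proof
  let ?P = "\<lambda>n. {c. (k dvd n \<longrightarrow> c \<in> ideal_power J (n div k)) \<and> (\<not> k dvd n \<longrightarrow> c = 0)}"
  have ideal: "is_ideal (?P n)" for n
    using is_ideal_power[of J "n div k"] by (auto simp: is_ideal_iff)
  have mul: "x * y \<in> ?P (i + j)" if "x \<in> ?P i" "y \<in> ?P j" for x y i j
  proof (cases "k dvd i \<and> k dvd j")
    case True
    then show ?thesis using that ideal_power_mult[of x J "i div k" y "j div k"]
      by (simp add: div_plus_div_distrib_dvd_left)
  next
    case False
    then have "x * y = 0" using that by auto
    then show ?thesis using ideal_0[OF ideal] by metis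
  qed
  show "?L \<subseteq> ?R"
  proof
    fix p assume "p \<in> ?L"
    then have "coeff p n \<in> ?P n" for n
    proof (induction p arbitrary: n rule: subalgebra_gen.induct)
      case (const c)
      have "coeff [:c:] n = (if n = 0 then c else 0)" by (cases n) auto
      then show ?case using ideal_0[OF ideal, of n] by auto
    next
      case (gen p)
      then obtain c where "c \<in> J" "p = monom c k" by auto
      moreover have "c * 1 \<in> ideal_mult J UNIV" using \<open>c \<in> J\<close> by (intro ideal_mult_memI) auto
      ultimately show ?case using ideal_0[OF ideal, of n] assms by auto
    next
      case (add p q)
      show ?case unfolding coeff_add by (rule ideal_add[OF ideal add.IH])
    next
      case (mult p q)
      have "coeff p i * coeff q (n - i) \<in> ?P n" if "i \<le> n" for i
        using mul[OF mult.IH(1)[of i] mult.IH(2)[of "n - i"]] le_add_diff_inverse[OF that]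
        by (simp only:)
      then show ?case unfolding coeff_mult by (intro ideal_sum[OF ideal]) simp
    qed
    then show "p \<in> ?R" by simp
  qed
  show "?R \<subseteq> ?L"
  proof
    fix p assume p: "p \<in> ?R"
    have zero: "0 \<in> ?L" using subalgebra_gen.const[of 0] by simp
    have mon: "ideal_power J n \<subseteq> {c. monom c (k * n) \<in> ?L}" for n
    proof (induction n)
      case 0
      show ?case by (auto simp: monom_0 intro: subalgebra_gen.const)
    next
      case (Suc n)
      let ?K = "{c. monom c (k * Suc n) \<in> ?L}"
      have "is_ideal ?K"
        unfolding is_ideal_iff
      proof (intro conjI ballI allI)
        show "0 \<in> ?K" using zero by simp
      next
        fix x y assume "x \<in> ?K" "y \<in> ?K"
        then show "x + y \<in> ?K" using subalgebra_gen.add[of _ _ "monom y (k * Suc n)"]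
          by (simp flip: add_monom)
      next
        fix c x assume "x \<in> ?K"
        then show "c * x \<in> ?K"
          using subalgebra_gen.mult[OF subalgebra_gen.const[of c], of "monom x (k * Suc n)"]
          by (simp add: smult_monom)
      qed
      moreover have "u * v \<in> ?K" if "u \<in> J" "v \<in> ideal_power J n" for u v
      proof -
        have "monom u k \<in> ?L" using that by (intro subalgebra_gen.gen) auto
        moreover have "monom v (k * n) \<in> ?L" using that Suc by auto
        ultimately show ?thesis using subalgebra_gen.mult by (fastforce simp: mult_monom)
      qed
      ultimately show ?case
        unfolding ideal_power.simps ideal_mult_def by (intro ideal_gen_minimal) auto
    qed
    have mon': "monom (coeff p i) i \<in> ?L" for i
      using p mon[of "i div k"] zero by (cases "k dvd i") auto
    have "(\<Sum>i\<le>n. monom (coeff p i) i) \<in> ?L" for n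
      by (induction n) (use mon' subalgebra_gen.add in auto)
    from this[of "degree p"] show "p \<in> ?L" by (simp only: poly_as_sum_of_monoms)
  qed
qed

lemma standard_graded_veronese_iff:
  assumes "a 0 = UNIV" and "\<And>i. i \<ge> 1 \<Longrightarrow> is_ideal (a i)" and k: "k \<ge> 1"
  shows "standard_graded_veronese k a \<longleftrightarrow> (\<forall>n\<ge>1. a (k * n) = ideal_power (a k) n)"
proof -
  have a0: "0 \<in> a n" for n
    using assms(1,2) ideal_0[of "a n"] by (cases n) auto
  let ?W = "{p. \<forall>n. (k dvd n \<longrightarrow> coeff p n \<in> ideal_power (a k) (n div k)) \<and>
                   (\<not> k dvd n \<longrightarrow> coeff p n = 0)}"
  have V: "monom c (k * n) \<in> veronese k a \<longleftrightarrow> c \<in> a (k * n)" for c n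
    using a0 by (auto simp: veronese_def rees_algebra_def)
  have W: "monom c (k * n) \<in> ?W \<longleftrightarrow> c \<in> ideal_power (a k) n" for c n
    using k ideal_0[OF is_ideal_power] by auto
  have "standard_graded_veronese k a \<longleftrightarrow> veronese k a = ?W"
    by (simp only: standard_graded_veronese_def subalgebra_gen_monom[OF k])
  also have "\<dots> \<longleftrightarrow> (\<forall>n. a (k * n) = ideal_power (a k) n)"
  proof
    assume eq: "veronese k a = ?W"
    have "c \<in> a (k * n) \<longleftrightarrow> c \<in> ideal_power (a k) n" for c n
      by (rule trans[OF V[symmetric] trans[OF arg_cong[where f = "(\<in>) (monom c (k * n))", OF eq] W]])
    then show "\<forall>n. a (k * n) = ideal_power (a k) n" by blast
  next
    assume *: "\<forall>n. a (k * n) = ideal_power (a k) n"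
    have eq: "a n = ideal_power (a k) (n div k)" if "k dvd n" for n
      using *[rule_format, of "n div k"] that by simp
    have "p \<in> veronese k a \<longleftrightarrow> p \<in> ?W" for p
    proof -
      have "p \<in> veronese k a \<longleftrightarrow>
          (\<forall>n. coeff p n \<in> a n \<and> (\<not> k dvd n \<longrightarrow> coeff p n = 0))"
        by (auto simp: veronese_def rees_algebra_def)
      also have "\<dots> \<longleftrightarrow> p \<in> ?W"
        unfolding mem_Collect_eq
      proof (intro all_cong1)
        fix n
        show "(coeff p n \<in> a n \<and> (\<not> k dvd n \<longrightarrow> coeff p n = 0)) \<longleftrightarrow>
          (k dvd n \<longrightarrow> coeff p n \<in> ideal_power (a k) (n div k)) \<and>
          (\<not> k dvd n \<longrightarrow> coeff p n = 0)"
          using eq[of n] a0[of n] by (cases "k dvd n") (simp_all, metis)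
      qed
      finally show ?thesis .
    qed
    then show "veronese k a = ?W" by blast
  qed
  also have "\<dots> \<longleftrightarrow> (\<forall>n\<ge>1. a (k * n) = ideal_power (a k) n)"
  proof -
    have "a (k * 0) = ideal_power (a k) 0" using assms(1) by simp
    then show ?thesis by (metis One_nat_def Suc_leI gr0I)
  qed
  finally show ?thesis .
qed

text \<open>
  Both arguments are subsets of one ambient ring. If \<open>A\<close> contains \<open>0\<close> and \<open>1\<close>, the equation forces
  the generators to lie in \<open>M\<close>.
\<close>

definition fin_gen_module :: "'b::comm_ring_1 set \<Rightarrow> 'b set \<Rightarrow> bool" where
  "fin_gen_module A M \<longleftrightarrow>
     (\<exists>G. finite G \<and> M = {\<Sum>g\<in>G. c g * g |c. \<forall>g\<in>G. c g \<in> A})"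

definition ideal_equivalent :: "(nat \<Rightarrow> 'a::comm_ring_1 set) \<Rightarrow> 'a set \<Rightarrow> bool" where
  "ideal_equivalent b I \<longleftrightarrow>
     (\<exists>m\<ge>1. \<forall>i\<ge>1. b (i + m) \<subseteq> ideal_power I i \<and> ideal_power I i \<subseteq> b i)"


section \<open>Resurgence number\<close>

definition resurgence :: "(nat \<Rightarrow> 'a set) \<Rightarrow> (nat \<Rightarrow> 'a set) \<Rightarrow> ereal" where
  "resurgence a b =
     Sup {ereal (real s / real r) |s r. s \<ge> 1 \<and> r \<ge> 1 \<and> \<not> a s \<subseteq> b r}"

end

(*
  If the supremum is finite and irrational it is not attained, so it depends only on the asymptotic
  order: with J = a_k, K = b_l and gamma = k / (l * rho), every element of J has asymptotic order
  lim ord_K(x^n) / n at least gamma, and no bound gamma' > gamma has this property, because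
  the integral closure of b_(n+h) lies in b_n for a fixed h.  The elements of order at least
  r + beta, placed in degree r, form (up to a shift) an ideal of the Rees algebra of K.  That
  algebra is Noetherian, so these ideals become stationary as beta decreases to 0.  Since the
  fractional parts of n * gamma take arbitrarily small positive values, some power J^n has order
  strictly above n * gamma, contradicting the choice of gamma.
*)
theory Submission
  imports Defs "HOL-Analysis.Kronecker_Approximation_Theorem"
begin

section \<open>Hilbert's basis theorem for subrings\<close>

text \<open>Asymptotic orders are classically seen to be rational through Rees valuations. Here a
  uniform gap replaces them: the index \<open>N\<close> at which the ideals of the Rees algebra
  become stationary serves all degrees at once, so no element has order strictly between
  \<open>d\<close> and \<open>d + 1 / (N + 1)\<close> for any integer \<open>d \<ge> h + 1\<close>.
  A multiple of an irrational \<gamma> that falls into such a gap is pushed to its upper end for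
  every element of \<open>J\<close> simultaneously, and taking roots gives one common \<gamma>' >
  \<gamma>. The contradiction comes from rounding \<open>s\<close> and \<open>r\<close> to multiples
  of \<open>k\<close> and \<open>l\<close>, which costs only a constant: with \<gamma>' every
  failing containment satisfies \<open>s \<le> \<rho>' * r + D\<close> for some \<rho>' < \<rho>, so
  finitely many pairs have a ratio near \<rho> and the supremum would be a maximum, hence rational.
  The Rees algebra is a subset of a polynomial ring and not a type, so Noetherianity is developed
  for subsets that are subrings.\<close>

definition subring_set :: "'r::comm_ring_1 set \<Rightarrow> bool" where
  "subring_set A \<longleftrightarrow> 1 \<in> A \<and> (\<forall>x\<in>A. \<forall>y\<in>A. x - y \<in> A \<and> x * y \<in> A)"

definition ideal_of :: "'r::comm_ring_1 set \<Rightarrow> 'r set \<Rightarrow> bool" where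
  "ideal_of A L \<longleftrightarrow> L \<subseteq> A \<and> 0 \<in> L \<and> (\<forall>x\<in>L. \<forall>y\<in>L. x - y \<in> L) \<and> (\<forall>c\<in>A. \<forall>x\<in>L. c * x \<in> L)"

definition noetherian_subring :: "'r::comm_ring_1 set \<Rightarrow> bool" where
  "noetherian_subring A \<longleftrightarrow> subring_set A \<and>
     (\<forall>L::nat \<Rightarrow> 'r set. (\<forall>j. ideal_of A (L j)) \<and> (\<forall>j. L j \<subseteq> L (Suc j)) \<longrightarrow>
        (\<exists>N. \<forall>j\<ge>N. L j = L N))"

text \<open>The subring \<open>A[y]\<close> of the ambient ring. As \<open>y\<close> may satisfy
  relations over \<open>A\<close>, the coefficients are not determined by the element.\<close>

definition adjoin :: "'r::comm_ring_1 set \<Rightarrow> 'r \<Rightarrow> 'r set" where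
  "adjoin A y = {\<Sum>i<n. a i * y ^ i |n a. \<forall>i. a i \<in> A}"

lemma adjoinI: "(\<And>i. a i \<in> A) \<Longrightarrow> (\<Sum>i<n. a i * y ^ i) \<in> adjoin A y"
  by (auto simp: adjoin_def)

lemma subring_set_0: "subring_set A \<Longrightarrow> 0 \<in> A"
  unfolding subring_set_def by (metis diff_self)

lemma subring_set_uminus: "subring_set A \<Longrightarrow> x \<in> A \<Longrightarrow> - x \<in> A"
  using subring_set_0[of A] unfolding subring_set_def by (metis diff_0)

lemma subring_set_add: "subring_set A \<Longrightarrow> x \<in> A \<Longrightarrow> y \<in> A \<Longrightarrow> x + y \<in> A"
  using subring_set_uminus[of A y] unfolding subring_set_def by (metis diff_minus_eq_add)

lemma ideal_of_uminus: "ideal_of A L \<Longrightarrow> x \<in> L \<Longrightarrow> - x \<in> L"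
  unfolding ideal_of_def by (metis diff_0)

lemma ideal_of_add: "ideal_of A L \<Longrightarrow> x \<in> L \<Longrightarrow> y \<in> L \<Longrightarrow> x + y \<in> L"
  using ideal_of_uminus[of A L y] unfolding ideal_of_def by (metis diff_minus_eq_add)

lemma noetherian_subringD:
  assumes "noetherian_subring A" "\<And>j. ideal_of A (L j)" "\<And>j. L j \<subseteq> L (Suc j)"
  obtains N where "\<And>j. j \<ge> N \<Longrightarrow> L j = L N"
  using assms unfolding noetherian_subring_def by meson

text \<open>Coefficient sequences of two elements get a common length only after padding with zeros;
  addition relies on this.\<close>

lemma adjoin_pad:
  assumes "subring_set A" "p \<in> adjoin A y"
  obtains n a where "\<And>i. a i \<in> A" "\<And>m. m \<ge> n \<Longrightarrow> p = (\<Sum>i<m. a i * y ^ i)"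
    "\<And>i. i \<ge> n \<Longrightarrow> a i = 0"
proof -
  obtain n a where na: "p = (\<Sum>i<n. a i * y ^ i)" "\<forall>i. a i \<in> A"
    using assms(2) by (auto simp: adjoin_def)
  define a' where "a' i = (if i < n then a i else 0)" for i
  have "p = (\<Sum>i<m. a' i * y ^ i)" if "m \<ge> n" for m
    unfolding na(1) by (rule sum.mono_neutral_cong_left) (use that in \<open>auto simp: a'_def\<close>)
  then show ?thesis
    using that[of a' n] na(2) subring_set_0[OF assms(1)] by (auto simp: a'_def)
qed

lemma subset_adjoin: "subring_set A \<Longrightarrow> A \<subseteq> adjoin A y"
proof
  fix c assume "subring_set A" "c \<in> A"
  then show "c \<in> adjoin A y"
    unfolding adjoin_def by (auto intro!: exI[of _ "Suc 0"] exI[of _ "\<lambda>i. c"])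
qed

lemma monomial_in_adjoin:
  assumes "subring_set A" "c \<in> A" shows "c * y ^ n \<in> adjoin A y"
proof -
  have "c * y ^ n = (\<Sum>i<Suc n. (if i = n then c else 0) * y ^ i)" by simp
  also have "\<dots> \<in> adjoin A y" using assms subring_set_0 by (intro adjoinI) auto
  finally show ?thesis .
qed

lemma adjoin_add:
  assumes "subring_set A" "p \<in> adjoin A y" "q \<in> adjoin A y" shows "p + q \<in> adjoin A y"
proof -
  obtain n a where a: "\<And>i. a i \<in> A" "\<And>m. m \<ge> n \<Longrightarrow> p = (\<Sum>i<m. a i * y ^ i)"
    using adjoin_pad[OF assms(1,2)] by metis
  obtain n' b where b: "\<And>i. b i \<in> A" "\<And>m. m \<ge> n' \<Longrightarrow> q = (\<Sum>i<m. b i * y ^ i)"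
    using adjoin_pad[OF assms(1,3)] by metis
  have "p + q = (\<Sum>i<max n n'. (a i + b i) * y ^ i)"
    using a(2)[of "max n n'"] b(2)[of "max n n'"] by (simp add: distrib_right sum.distrib)
  also have "\<dots> \<in> adjoin A y" by (intro adjoinI subring_set_add[OF assms(1)] a(1) b(1))
  finally show ?thesis .
qed

lemma adjoin_sum:
  assumes "subring_set A" "\<And>i. i \<in> I \<Longrightarrow> f i \<in> adjoin A y" shows "sum f I \<in> adjoin A y"
  using assms(2)
proof (induction I rule: infinite_finite_induct)
  case (insert x F)
  then show ?case by (auto intro: adjoin_add[OF assms(1)])
qed (use subset_adjoin[OF assms(1)] subring_set_0[OF assms(1)] in auto)

lemma subring_adjoin:
  assumes "subring_set A" shows "subring_set (adjoin A y)"
proof -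
  have mult: "p * q \<in> adjoin A y" if pq: "p \<in> adjoin A y" "q \<in> adjoin A y" for p q
  proof -
    obtain n a where a: "p = (\<Sum>i<n. a i * y ^ i)" "\<forall>i. a i \<in> A"
      using pq(1) by (auto simp: adjoin_def)
    obtain m b where b: "q = (\<Sum>i<m. b i * y ^ i)" "\<forall>i. b i \<in> A"
      using pq(2) by (auto simp: adjoin_def)
    have "p * q = (\<Sum>i<n. \<Sum>j<m. (a i * b j) * y ^ (i + j))"
      unfolding a(1) b(1) sum_product by (simp add: power_add mult_ac)
    then show ?thesis
      using a(2) b(2) assms
      by (auto intro!: adjoin_sum monomial_in_adjoin simp: subring_set_def)
  qed
  have m1: "-1 \<in> A" using subring_set_uminus[OF assms, of 1] assms by (auto simp: subring_set_def)
  have "p - q \<in> adjoin A y" if "p \<in> adjoin A y" "q \<in> adjoin A y" for p q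
  proof -
    have "(-1) * q \<in> adjoin A y" using mult m1 subset_adjoin[OF assms] that by blast
    then show ?thesis using adjoin_add[OF assms that(1)] by fastforce
  qed
  moreover have "1 \<in> adjoin A y" using subset_adjoin[OF assms] assms by (auto simp: subring_set_def)
  ultimately show ?thesis using mult by (auto simp: subring_set_def)
qed

lemma in_adjoin: "subring_set A \<Longrightarrow> y \<in> adjoin A y"
  using monomial_in_adjoin[of A 1 y 1] by (simp add: subring_set_def)

text \<open>Representations are not unique, so these are the coefficients at \<open>X ^ n\<close> of
  all polynomials of degree at most \<open>n\<close> over \<open>A\<close> whose value at
  \<open>y\<close> lies in \<open>L\<close>. In this way the classical argument for
  \<open>A[X]\<close> is carried out directly on its quotient \<open>A[y]\<close>.\<close>

definition lead_coeffs :: "'r::comm_ring_1 set \<Rightarrow> 'r \<Rightarrow> 'r set \<Rightarrow> nat \<Rightarrow> 'r set" where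
  "lead_coeffs A y L n =
     {c \<in> A. \<exists>a. (\<forall>i. a i \<in> A) \<and> (\<Sum>i<n. a i * y ^ i) + c * y ^ n \<in> L}"

lemma lead_coeffsI:
  "(\<Sum>i<n. a i * y ^ i) + c * y ^ n \<in> L \<Longrightarrow> (\<And>i. a i \<in> A) \<Longrightarrow> c \<in> A \<Longrightarrow> c \<in> lead_coeffs A y L n"
  by (auto simp: lead_coeffs_def)

lemma ideal_of_lead_coeffs:
  assumes A: "subring_set A" and L: "ideal_of (adjoin A y) L"
  shows "ideal_of A (lead_coeffs A y L n)"
proof -
  let ?C = "lead_coeffs A y L n"
  have "0 \<in> ?C"
    using L subring_set_0[OF A] by (auto simp: lead_coeffs_def ideal_of_def intro!: exI[of _ "\<lambda>_. 0"])
  moreover have "c - d \<in> ?C" if cd: "c \<in> ?C" "d \<in> ?C" for c d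
  proof -
    obtain f where f: "\<forall>i. f i \<in> A" "(\<Sum>i<n. f i * y ^ i) + c * y ^ n \<in> L" "c \<in> A"
      using cd(1) by (auto simp: lead_coeffs_def)
    obtain g where g: "\<forall>i. g i \<in> A" "(\<Sum>i<n. g i * y ^ i) + d * y ^ n \<in> L" "d \<in> A"
      using cd(2) by (auto simp: lead_coeffs_def)
    have "((\<Sum>i<n. f i * y ^ i) + c * y ^ n) - ((\<Sum>i<n. g i * y ^ i) + d * y ^ n) \<in> L"
      using L f(2) g(2) by (simp add: ideal_of_def)
    then have "(\<Sum>i<n. (f i - g i) * y ^ i) + (c - d) * y ^ n \<in> L"
      by (simp add: left_diff_distrib sum_subtractf algebra_simps)
    then show ?thesis
      by (rule lead_coeffsI) (use A f g in \<open>auto simp: subring_set_def\<close>)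
  qed
  moreover have "c * d \<in> ?C" if cd: "c \<in> A" "d \<in> ?C" for c d
  proof -
    obtain g where g: "\<forall>i. g i \<in> A" "(\<Sum>i<n. g i * y ^ i) + d * y ^ n \<in> L" "d \<in> A"
      using cd(2) by (auto simp: lead_coeffs_def)
    have "c \<in> adjoin A y" using cd(1) subset_adjoin[OF A] by blast
    then have "c * ((\<Sum>i<n. g i * y ^ i) + d * y ^ n) \<in> L"
      using L g(2) unfolding ideal_of_def by blast
    then have "(\<Sum>i<n. (c * g i) * y ^ i) + (c * d) * y ^ n \<in> L"
      by (simp add: sum_distrib_left algebra_simps)
    then show ?thesis
      by (rule lead_coeffsI) (use A g cd in \<open>auto simp: subring_set_def\<close>)
  qed
  ultimately show ?thesis by (auto simp: ideal_of_def lead_coeffs_def)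
qed

text \<open>Multiplication by \<open>y\<close> shifts the coefficients by one, and \<open>L\<close>
  absorbs it because \<open>y\<close> lies in \<open>adjoin A y\<close>.\<close>

lemma lead_coeffs_Suc:
  assumes A: "subring_set A" and L: "ideal_of (adjoin A y) L"
  shows "lead_coeffs A y L n \<subseteq> lead_coeffs A y L (Suc n)"
proof
  fix c assume "c \<in> lead_coeffs A y L n"
  then obtain f where f: "\<forall>i. f i \<in> A" "(\<Sum>i<n. f i * y ^ i) + c * y ^ n \<in> L" "c \<in> A"
    by (auto simp: lead_coeffs_def)
  define g where "g i = (case i of 0 \<Rightarrow> 0 | Suc i \<Rightarrow> f i)" for i
  have "y * ((\<Sum>i<n. f i * y ^ i) + c * y ^ n) \<in> L"
    using L f(2) in_adjoin[OF A] by (auto simp: ideal_of_def)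
  also have "y * ((\<Sum>i<n. f i * y ^ i) + c * y ^ n) = (\<Sum>i<Suc n. g i * y ^ i) + c * y ^ Suc n"
    unfolding sum.lessThan_Suc_shift g_def by (simp add: sum_distrib_left algebra_simps)
  finally have "(\<Sum>i<Suc n. g i * y ^ i) + c * y ^ Suc n \<in> L" .
  moreover have "\<forall>i. g i \<in> A" using f subring_set_0[OF A] by (auto simp: g_def split: nat.split)
  ultimately show "c \<in> lead_coeffs A y L (Suc n)" using f(3) unfolding lead_coeffs_def by blast
qed

lemma lead_coeffs_mono: "L \<subseteq> L' \<Longrightarrow> lead_coeffs A y L n \<subseteq> lead_coeffs A y L' n"
  by (auto simp: lead_coeffs_def)

text \<open>Descent on the number of terms: an element of \<open>L'\<close> shares its top term with
  an element of \<open>L\<close>, and their difference lies in \<open>L'\<close> and is one term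
  shorter.\<close>

lemma ideal_eqI_lead_coeffs:
  assumes A: "subring_set A" and L: "ideal_of (adjoin A y) L" and L': "ideal_of (adjoin A y) L'"
    and sub: "L \<subseteq> L'" and lc: "\<And>n. lead_coeffs A y L' n \<subseteq> lead_coeffs A y L n"
  shows "L' = L"
proof -
  have *: "(\<Sum>i<n. f i * y ^ i) \<in> L" if "\<forall>i. f i \<in> A" "(\<Sum>i<n. f i * y ^ i) \<in> L'" for f n
    using that
  proof (induction n arbitrary: f)
    case 0
    then show ?case using L by (simp add: ideal_of_def)
  next
    case (Suc n)
    have "f n \<in> lead_coeffs A y L' n" using Suc.prems by (auto simp: lead_coeffs_def)
    then have "f n \<in> lead_coeffs A y L n" using lc by blast
    then obtain g where g: "\<forall>i. g i \<in> A" "(\<Sum>i<n. g i * y ^ i) + f n * y ^ n \<in> L"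
      by (auto simp: lead_coeffs_def)
    have "(\<Sum>i<Suc n. f i * y ^ i) - ((\<Sum>i<n. g i * y ^ i) + f n * y ^ n) \<in> L'"
      using L' Suc.prems(2) g(2) sub unfolding ideal_of_def by blast
    then have "(\<Sum>i<n. (f i - g i) * y ^ i) \<in> L'"
      by (simp add: left_diff_distrib sum_subtractf)
    then have "(\<Sum>i<n. (f i - g i) * y ^ i) \<in> L"
      using Suc.prems(1) g(1) A by (intro Suc.IH) (auto simp: subring_set_def)
    from ideal_of_add[OF L this g(2)] show ?case
      by (simp add: left_diff_distrib sum_subtractf)
  qed
  have "L' \<subseteq> L"
  proof
    fix p assume "p \<in> L'"
    moreover from this have "p \<in> adjoin A y" using L' by (auto simp: ideal_of_def)
    then obtain n a where "p = (\<Sum>i<n. a i * y ^ i)" "\<forall>i. a i \<in> A" by (auto simp: adjoin_def)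
    ultimately show "p \<in> L" using * by blast
  qed
  then show ?thesis using sub by blast
qed

theorem noetherian_adjoin:
  assumes N: "noetherian_subring A" shows "noetherian_subring (adjoin A y)"
proof -
  have A: "subring_set A" using N by (simp add: noetherian_subring_def)
  have "\<exists>N. \<forall>j\<ge>N. L j = L N"
    if L: "\<And>j. ideal_of (adjoin A y) (L j)" and inc: "\<And>j. L j \<subseteq> L (Suc j)" for L
  proof -
    have Lmono: "L i \<subseteq> L j" if "i \<le> j" for i j using lift_Suc_mono_le[of L, OF inc that] .
    let ?C = "\<lambda>j. lead_coeffs A y (L j)"
    have Cmono: "?C i n \<subseteq> ?C j m" if "i \<le> j" "n \<le> m" for i j n m
    proof -
      have "?C i n \<subseteq> ?C j n" by (rule lead_coeffs_mono[OF Lmono[OF that(1)]])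
      also have "\<dots> \<subseteq> ?C j m"
        using lift_Suc_mono_le[of "?C j", OF lead_coeffs_Suc[OF A L] that(2)] .
      finally show ?thesis .
    qed
    have idl: "ideal_of A (?C j n)" for j n by (rule ideal_of_lead_coeffs[OF A L])
    \<comment> \<open>Leading coefficients grow in both indices, so the diagonal chain controls all
      degrees beyond \<open>D\<close> at once. The finitely many remaining degrees get their own
      thresholds \<open>E n\<close>.\<close>
    obtain D where D: "\<And>j. j \<ge> D \<Longrightarrow> ?C j j = ?C D D"
      using noetherian_subringD[OF N, of "\<lambda>j. ?C j j"] idl Cmono by (metis le_SucI order_refl)
    have "\<exists>E. \<forall>j\<ge>E. ?C j n = ?C E n" for n
      using noetherian_subringD[OF N, of "\<lambda>j. ?C j n"] idl Cmono by (metis le_SucI order_refl)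
    then obtain E where E: "\<And>n j. j \<ge> E n \<Longrightarrow> ?C j n = ?C (E n) n" by metis
    define B where "B = Max (insert D (E ` {..D}))"
    have BD: "D \<le> B" by (simp add: B_def)
    have BE: "E n \<le> B" if "n \<le> D" for n unfolding B_def using that by (intro Max_ge) auto
    have "L j = L B" if j: "j \<ge> B" for j
    proof (rule ideal_eqI_lead_coeffs[OF A L L Lmono[OF j]])
      fix n
      show "?C j n \<subseteq> ?C B n"
      proof (cases "n \<le> D")
        case True
        then show ?thesis using E[of n j] E[of n B] BE[of n] j by force
      next
        case False
        have "?C j n \<subseteq> ?C (max j n) (max j n)" by (rule Cmono) auto
        also have "\<dots> = ?C D D" using False by (intro D) auto
        also have "\<dots> \<subseteq> ?C B n" using False BD by (intro Cmono) auto
        finally show ?thesis .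
      qed
    qed
    then show ?thesis by blast
  qed
  then show ?thesis using subring_adjoin[OF A] by (auto simp: noetherian_subring_def)
qed


section \<open>From the base ring to its Rees algebras\<close>

lemma noetherian_constants:
  assumes fg: "\<And>I::'a::comm_ring_1 set. is_ideal I \<Longrightarrow> \<exists>G. finite G \<and> I = ideal_gen G"
  shows "noetherian_subring (range (\<lambda>c::'a. [:c:]))"
proof -
  let ?A = "range (\<lambda>c::'a. [:c:])"
  have A: "subring_set ?A"
    unfolding subring_set_def by (auto simp: one_pCons)
  have "\<exists>N. \<forall>j\<ge>N. L j = L N"
    if L: "\<And>j. ideal_of ?A (L j)" and inc: "\<And>j. L j \<subseteq> L (Suc j)" for L
  proof -
    have Lmono: "L i \<subseteq> L j" if "i \<le> j" for i j using lift_Suc_mono_le[of L, OF inc that] .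
    define I where "I j = {c. [:c:] \<in> L j}" for j
    have I: "is_ideal (I j)" for j
      unfolding is_ideal_iff
    proof (intro conjI ballI allI)
      show "0 \<in> I j" using L[of j] by (simp add: I_def ideal_of_def)
    next
      fix x y assume "x \<in> I j" "y \<in> I j"
      then show "x + y \<in> I j" using ideal_of_add[OF L[of j], of "[:x:]" "[:y:]"] by (simp add: I_def)
    next
      fix c x assume "x \<in> I j"
      then have "[:c:] * [:x:] \<in> L j" using L[of j] unfolding ideal_of_def I_def by blast
      then show "c * x \<in> I j" by (simp add: I_def mult.commute)
    qed
    have Imono: "I i \<subseteq> I j" if "i \<le> j" for i j using Lmono[OF that] by (auto simp: I_def)
    \<comment> \<open>Finite generation becomes the chain condition: the generators of the union
      already lie in one member of the chain.\<close>
    have "is_ideal (\<Union>j. I j)"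
      unfolding is_ideal_iff
    proof (intro conjI ballI allI)
      fix x y assume "x \<in> (\<Union>j. I j)" "y \<in> (\<Union>j. I j)"
      then obtain i j where "x \<in> I i" "y \<in> I j" by blast
      then have "x \<in> I (max i j)" "y \<in> I (max i j)"
        using Imono[of i "max i j"] Imono[of j "max i j"] by auto
      then show "x + y \<in> (\<Union>j. I j)" using ideal_add[OF I] by blast
    qed (use ideal_0[OF I] ideal_scale[OF I] in \<open>auto, blast\<close>)
    from fg[OF this] obtain G where G: "finite G" "(\<Union>j. I j) = ideal_gen G" by blast
    have "\<exists>N. G \<subseteq> I N"
    proof -
      have "\<forall>g\<in>G. \<exists>j. g \<in> I j" using G(2) ideal_gen_superset[of G] by blast
      then obtain f where f: "\<And>g. g \<in> G \<Longrightarrow> g \<in> I (f g)" by metis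
      have "g \<in> I (Max (insert 0 (f ` G)))" if "g \<in> G" for g
      proof -
        have "f g \<le> Max (insert 0 (f ` G))" using G(1) that by (intro Max_ge) auto
        then show ?thesis using f[OF that] Imono by blast
      qed
      then show ?thesis by blast
    qed
    then obtain N where N: "G \<subseteq> I N" by blast
    have sub: "I j \<subseteq> I N" for j using ideal_gen_minimal[OF N I] G(2) by blast
    have "L j \<subseteq> L N" for j
    proof
      fix p assume "p \<in> L j"
      moreover from this obtain c where "p = [:c:]" using L[of j] unfolding ideal_of_def by blast
      ultimately show "p \<in> L N" using sub[of j] by (auto simp: I_def)
    qed
    then show ?thesis using Lmono by blast
  qed
  then show ?thesis using A by (simp add: noetherian_subring_def)
qed

lemma subalgebra_gen_mono: "X \<subseteq> Y \<Longrightarrow> subalgebra_gen X \<subseteq> subalgebra_gen Y"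
proof
  fix p assume "X \<subseteq> Y" "p \<in> subalgebra_gen X"
  from this(2,1) show "p \<in> subalgebra_gen Y"
    by (induction rule: subalgebra_gen.induct) (auto intro: subalgebra_gen.intros)
qed

lemma subalgebra_gen_idem: "X \<subseteq> subalgebra_gen Y \<Longrightarrow> subalgebra_gen X \<subseteq> subalgebra_gen Y"
proof
  fix p assume "X \<subseteq> subalgebra_gen Y" "p \<in> subalgebra_gen X"
  from this(2,1) show "p \<in> subalgebra_gen Y"
    by (induction rule: subalgebra_gen.induct) (auto intro: subalgebra_gen.intros)
qed

lemma subalgebra_gen_subset_subring:
  assumes "subring_set A" "range (\<lambda>c. [:c:]) \<subseteq> A" "X \<subseteq> A"
  shows "subalgebra_gen X \<subseteq> A"
proof
  fix p assume "p \<in> subalgebra_gen X"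
  then show "p \<in> A"
    using assms subring_set_add[OF assms(1)]
    by (induction rule: subalgebra_gen.induct) (auto simp: subring_set_def)
qed

lemma adjoin_subset_subalgebra_gen:
  assumes "A \<subseteq> subalgebra_gen X" "y \<in> subalgebra_gen X"
  shows "adjoin A y \<subseteq> subalgebra_gen X"
proof -
  have pow: "y ^ n \<in> subalgebra_gen X" for n
    using subalgebra_gen.const[of 1 X] assms(2)
    by (induction n) (auto intro: subalgebra_gen.mult simp: one_pCons)
  have "(\<Sum>i<n. a i * y ^ i) \<in> subalgebra_gen X" if "\<forall>i. a i \<in> A" for n :: nat and a
    using subalgebra_gen.const[of 0 X] pow that assms(1)
    by (induction n) (auto intro!: subalgebra_gen.add subalgebra_gen.mult)
  then show ?thesis by (auto simp: adjoin_def)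
qed

text \<open>Adjoining the elements of \<open>X\<close> one at a time preserves Noetherianity. The
  subring reached in this way is only sandwiched during the induction; it equals
  \<open>subalgebra_gen X\<close> because the latter is contained in every subring that contains the
  constants and \<open>X\<close>.\<close>

lemma noetherian_subalgebra_gen:
  assumes fg: "\<And>I::'a::comm_ring_1 set. is_ideal I \<Longrightarrow> \<exists>G. finite G \<and> I = ideal_gen G"
    and "finite (X :: 'a poly set)"
  shows "noetherian_subring (subalgebra_gen X)"
proof -
  have "\<exists>A. noetherian_subring A \<and> range (\<lambda>c. [:c:]) \<subseteq> A \<and> X \<subseteq> A \<and> A \<subseteq> subalgebra_gen X"
    using \<open>finite X\<close>
  proof (induction X rule: finite_induct)
    case empty
    show ?case
      using noetherian_constants[OF fg]
      by (intro exI[of _ "range (\<lambda>c. [:c:])"]) (auto intro: subalgebra_gen.const)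
  next
    case (insert y X)
    then obtain A where A: "noetherian_subring A" "range (\<lambda>c. [:c:]) \<subseteq> A" "X \<subseteq> A"
      "A \<subseteq> subalgebra_gen X" by blast
    have sub: "subring_set A" using A(1) by (simp add: noetherian_subring_def)
    have "A \<subseteq> subalgebra_gen (insert y X)"
      using A(4) subalgebra_gen_mono[of X "insert y X"] by blast
    then have "adjoin A y \<subseteq> subalgebra_gen (insert y X)"
      by (rule adjoin_subset_subalgebra_gen) (simp add: subalgebra_gen.gen)
    then show ?case
      using noetherian_adjoin[OF A(1), of y] subset_adjoin[OF sub, of y] in_adjoin[OF sub, of y] A
      by (intro exI[of _ "adjoin A y"]) auto
  qed
  then obtain A where A: "noetherian_subring A" "range (\<lambda>c. [:c:]) \<subseteq> A" "X \<subseteq> A"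
      "A \<subseteq> subalgebra_gen X" by blast
  moreover have "subalgebra_gen X \<subseteq> A"
    using A by (intro subalgebra_gen_subset_subring) (auto simp: noetherian_subring_def)
  ultimately have "A = subalgebra_gen X" by blast
  then show ?thesis using A(1) by simp
qed

lemma rees_algebra_ideal_power:
  "rees_algebra (ideal_power K) = subalgebra_gen {monom c 1 |c. c \<in> K}"
  using subalgebra_gen_monom[of 1 K] by (simp add: rees_algebra_def)

text \<open>The degree-one elements \<open>monom c 1\<close> with \<open>c\<close> in
  \<open>K\<close> need not be finite in number. Generators of \<open>K\<close> suffice, because the
  \<open>c\<close> with \<open>monom c 1\<close> in a given subalgebra form an ideal.\<close>

theorem noetherian_rees_algebra:
  assumes fg: "\<And>I::'a::comm_ring_1 set. is_ideal I \<Longrightarrow> \<exists>G. finite G \<and> I = ideal_gen G"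
    and K: "is_ideal (K :: 'a set)"
  shows "noetherian_subring (rees_algebra (ideal_power K))"
proof -
  obtain G where G: "finite G" "K = ideal_gen G" using fg[OF K] by blast
  let ?X = "(\<lambda>c. monom c 1) ` G"
  have "is_ideal {c. monom c 1 \<in> subalgebra_gen ?X}"
    unfolding is_ideal_iff
  proof (intro conjI ballI allI)
    show "0 \<in> {c. monom c 1 \<in> subalgebra_gen ?X}" using subalgebra_gen.const[of 0] by simp
  next
    fix x y assume "x \<in> {c. monom c 1 \<in> subalgebra_gen ?X}" "y \<in> {c. monom c 1 \<in> subalgebra_gen ?X}"
    then show "x + y \<in> {c. monom c 1 \<in> subalgebra_gen ?X}"
      using subalgebra_gen.add[of "monom x 1" ?X "monom y 1"] by (simp add: add_monom)
  next
    fix c x assume "x \<in> {c. monom c 1 \<in> subalgebra_gen ?X}"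
    then show "c * x \<in> {c. monom c 1 \<in> subalgebra_gen ?X}"
      using subalgebra_gen.mult[OF subalgebra_gen.const[of c], of "monom x 1" ?X]
      by (simp add: smult_monom)
  qed
  then have "K \<subseteq> {c. monom c 1 \<in> subalgebra_gen ?X}"
    unfolding G(2) by (intro ideal_gen_minimal) (auto intro: subalgebra_gen.gen)
  then have "subalgebra_gen {monom c 1 |c. c \<in> K} \<subseteq> subalgebra_gen ?X"
    by (intro subalgebra_gen_idem) auto
  moreover have "subalgebra_gen ?X \<subseteq> subalgebra_gen {monom c 1 |c. c \<in> K}"
    using ideal_gen_superset[of G] G(2) by (intro subalgebra_gen_mono) auto
  ultimately have "rees_algebra (ideal_power K) = subalgebra_gen ?X"
    unfolding rees_algebra_ideal_power by blast
  then show ?thesis using noetherian_subalgebra_gen[OF fg, of ?X] G(1) by simp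
qed

section \<open>Asymptotic order with respect to an ideal\<close>

lemma is_ideal_mult: "is_ideal (ideal_mult I J)"
  by (simp add: ideal_mult_def is_ideal_gen)

lemma ideal_mult_least:
  "is_ideal L \<Longrightarrow> (\<And>x y. x \<in> I \<Longrightarrow> y \<in> J \<Longrightarrow> x * y \<in> L) \<Longrightarrow> ideal_mult I J \<subseteq> L"
  unfolding ideal_mult_def by (rule ideal_gen_minimal) auto

lemma ideal_power_antimono: "m \<le> n \<Longrightarrow> ideal_power I n \<subseteq> ideal_power I m"
  by (rule lift_Suc_antimono_le[of "ideal_power I"]) (rule ideal_power_Suc_subset)

lemma power_in_ideal_power: "y \<in> ideal_power I r \<Longrightarrow> y ^ n \<in> ideal_power I (n * r)"
proof (induction n)
  case (Suc n)
  then show ?case using ideal_power_mult[of y I r "y ^ n" "n * r"] by simp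
qed simp

lemma ideal_power_add_subset:
  "ideal_power I (i + j) \<subseteq> ideal_mult (ideal_power I i) (ideal_power I j)"
proof (induction i)
  case 0
  show ?case using ideal_mult_memI[of 1 UNIV _ "ideal_power I j"] by auto
next
  case (Suc i)
  let ?L = "ideal_mult (ideal_power I (Suc i)) (ideal_power I j)"
  have L: "is_ideal ?L" by (rule is_ideal_mult)
  have "u * v \<in> ?L" if u: "u \<in> I" and v: "v \<in> ideal_power I (i + j)" for u v
  proof -
    have "is_ideal {v. u * v \<in> ?L}"
      using L by (auto simp: is_ideal_iff distrib_left mult.left_commute simp del: ideal_power.simps)
    moreover have "u * (p * q) \<in> ?L" if "p \<in> ideal_power I i" "q \<in> ideal_power I j" for p q
    proof -
      have "u * p \<in> ideal_power I (Suc i)" using u that(1) by (simp add: ideal_mult_memI)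
      from ideal_mult_memI[OF this that(2)] show ?thesis by (simp add: mult.assoc)
    qed
    ultimately have "ideal_mult (ideal_power I i) (ideal_power I j) \<subseteq> {v. u * v \<in> ?L}"
      by (intro ideal_mult_least) auto
    then show ?thesis using Suc v by blast
  qed
  then have "ideal_mult I (ideal_power I (i + j)) \<subseteq> ?L" by (intro ideal_mult_least[OF L])
  then show ?case by simp
qed

text \<open>Provides the shape that an integral equation over \<open>ideal_power I m\<close>
  requires.\<close>

lemma ideal_power_power_subset:
  "ideal_power I (n * m) \<subseteq> ideal_power (ideal_power I m) n"
proof (induction n)
  case (Suc n)
  have "ideal_power I (Suc n * m) \<subseteq> ideal_mult (ideal_power I m) (ideal_power I (n * m))"
    using ideal_power_add_subset[of I m "n * m"] by simp
  also have "\<dots> \<subseteq> ideal_power (ideal_power I m) (Suc n)"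
    unfolding ideal_power.simps
    by (intro ideal_mult_least) (use Suc in \<open>auto intro: ideal_mult_memI is_ideal_mult\<close>)
  finally show ?case .
qed simp

text \<open>The elements \<open>y\<close> with \<open>lim n. ord\<^sub>K (y ^ n) / n \<ge> \<gamma>\<close>.\<close>

definition order_ideal :: "'a::comm_ring_1 set \<Rightarrow> real \<Rightarrow> 'a set" where
  "order_ideal K \<gamma> =
     {y. \<forall>\<delta><\<gamma>. \<exists>n\<ge>1. \<exists>r. real n * \<delta> \<le> real r \<and> y ^ n \<in> ideal_power K r}"

lemma order_idealE:
  assumes "y \<in> order_ideal K \<gamma>" "\<delta> < \<gamma>"
  obtains n r where "n \<ge> 1" "real n * \<delta> \<le> real r" "y ^ n \<in> ideal_power K r"
  using assms unfolding order_ideal_def by blast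

lemma order_ideal_antimono: "\<gamma> \<le> \<gamma>' \<Longrightarrow> order_ideal K \<gamma>' \<subseteq> order_ideal K \<gamma>"
  by (auto simp: order_ideal_def)

lemma order_ideal_mult:
  assumes y: "y \<in> order_ideal K \<gamma>" and z: "z \<in> order_ideal K \<gamma>'"
  shows "y * z \<in> order_ideal K (\<gamma> + \<gamma>')"
  unfolding order_ideal_def
proof (intro CollectI allI impI)
  fix \<delta> :: real assume \<delta>: "\<delta> < \<gamma> + \<gamma>'"
  \<comment> \<open>Half of the slack goes to each factor:
    \<open>\<delta> = (\<gamma> - e) + (\<gamma>' - e)\<close>.\<close>
  define e where "e = (\<gamma> + \<gamma>' - \<delta>) / 2"
  have e: "e > 0" using \<delta> by (simp add: e_def)
  obtain n r where n: "n \<ge> 1" "real n * (\<gamma> - e) \<le> real r" "y ^ n \<in> ideal_power K r"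
    using order_idealE[OF y, of "\<gamma> - e"] e by auto
  obtain m q where m: "m \<ge> 1" "real m * (\<gamma>' - e) \<le> real q" "z ^ m \<in> ideal_power K q"
    using order_idealE[OF z, of "\<gamma>' - e"] e by auto
  have "(y ^ n) ^ m * (z ^ m) ^ n \<in> ideal_power K (m * r + n * q)"
    using n m by (intro ideal_power_mult power_in_ideal_power)
  also have "(y ^ n) ^ m * (z ^ m) ^ n = (y * z) ^ (n * m)"
    by (simp add: power_mult_distrib mult.commute flip: power_mult)
  finally have "(y * z) ^ (n * m) \<in> ideal_power K (m * r + n * q)" .
  moreover have "real (n * m) * \<delta> \<le> real (m * r + n * q)"
  proof -
    have "real (n * m) * \<delta> = real m * (real n * (\<gamma> - e)) + real n * (real m * (\<gamma>' - e))"
      by (simp add: e_def field_simps)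
    also have "\<dots> \<le> real m * real r + real n * real q"
      using n m by (intro add_mono mult_left_mono) auto
    finally show ?thesis by simp
  qed
  moreover have "n * m \<ge> 1" using n m by simp
  ultimately show "\<exists>N\<ge>1. \<exists>r. real N * \<delta> \<le> real r \<and> (y * z) ^ N \<in> ideal_power K r" by blast
qed

text \<open>Negative targets are met by \<open>r = 0\<close>, since the zeroth power is the whole
  ring.\<close>

lemma order_ideal_nonpos: "\<gamma> \<le> 0 \<Longrightarrow> order_ideal K \<gamma> = UNIV"
  unfolding order_ideal_def
  by (intro UNIV_eq_I[symmetric] CollectI allI impI exI[of _ "1::nat"] conjI exI[of _ "0::nat"]) auto

lemma subset_order_ideal_1: "K \<subseteq> order_ideal K 1"
proof
  fix y assume "y \<in> K"
  then have "y ^ 1 \<in> ideal_power K 1" using ideal_mult_memI[of y K 1 UNIV] by simp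
  then show "y \<in> order_ideal K 1"
    by (auto simp: order_ideal_def intro!: exI[of _ "1::nat"] simp del: ideal_power.simps)
qed

text \<open>By the pigeonhole principle, a monomial of degree \<open>p * M\<close> in \<open>y\<close> and \<open>z\<close> is divisible by a
  product of \<open>M - 1\<close> factors \<open>y ^ p\<close> and \<open>z ^ p\<close>.\<close>

lemma power_add_in_ideal_power:
  assumes y: "y ^ p \<in> ideal_power K t" and z: "z ^ p \<in> ideal_power K t" and p: "p \<ge> 1"
  shows "(y + z) ^ (p * M) \<in> ideal_power K ((M - 1) * t)"
proof -
  have split: "w ^ i \<in> ideal_power K (i div p * t)" if "w ^ p \<in> ideal_power K t" for w and i :: nat
  proof -
    have "w ^ i = w ^ (i mod p) * (w ^ p) ^ (i div p)"
      by (simp flip: power_mult power_add)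
    then show ?thesis
      using power_in_ideal_power[OF that] ideal_scale[OF is_ideal_power] by metis
  qed
  have "of_nat ((p * M) choose i) * y ^ i * z ^ (p * M - i) \<in> ideal_power K ((M - 1) * t)"
    if i: "i \<le> p * M" for i
  proof -
    \<comment> \<open>Each of the two quotients loses less than one block, so by integrality their
      sum is at least \<open>M - 1\<close>.\<close>
    have "i < p * (i div p + 1)" "p * M - i < p * ((p * M - i) div p + 1)"
      using p dividend_less_times_div by fastforce+
    then have "p * M < p * (i div p + (p * M - i) div p + 2)"
      using i unfolding distrib_left by linarith
    then have "M < i div p + (p * M - i) div p + 2" using p by (simp only: mult_less_cancel1)
    then have "M - 1 \<le> i div p + (p * M - i) div p" by linarith
    then have "(M - 1) * t \<le> i div p * t + (p * M - i) div p * t"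
      by (metis add_mult_distrib mult_le_mono1)
    then have "y ^ i * z ^ (p * M - i) \<in> ideal_power K ((M - 1) * t)"
      using ideal_power_mult[OF split[OF y, of i] split[OF z, of "p * M - i"]]
        ideal_power_antimono by blast
    then show ?thesis
      using ideal_scale[OF is_ideal_power] by (metis mult.assoc)
  qed
  then show ?thesis
    unfolding binomial_ring by (intro ideal_sum[OF is_ideal_power]) auto
qed

lemma order_ideal_add:
  assumes y: "y \<in> order_ideal K \<gamma>" and z: "z \<in> order_ideal K \<gamma>"
  shows "y + z \<in> order_ideal K \<gamma>"
  unfolding order_ideal_def
proof (intro CollectI allI impI)
  fix \<delta> :: real assume \<delta>: "\<delta> < \<gamma>"
  show "\<exists>N\<ge>1. \<exists>r. real N * \<delta> \<le> real r \<and> (y + z) ^ N \<in> ideal_power K r"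
  proof (cases "\<delta> < 0")
    case True
    then show ?thesis by (intro exI[of _ "1::nat"] conjI exI[of _ "0::nat"]) auto
  next
    case False
    obtain \<epsilon> where \<epsilon>: "\<delta> < \<epsilon>" "\<epsilon> < \<gamma>" using dense[OF \<delta>] by blast
    obtain n r where n: "n \<ge> 1" "real n * \<epsilon> \<le> real r" "y ^ n \<in> ideal_power K r"
      using order_idealE[OF y \<epsilon>(2)] by auto
    obtain m q where m: "m \<ge> 1" "real m * \<epsilon> \<le> real q" "z ^ m \<in> ideal_power K q"
      using order_idealE[OF z \<epsilon>(2)] by auto
    define t where "t = min (m * r) (n * q)"
    have "(y ^ n) ^ m \<in> ideal_power K (m * r)" "(z ^ m) ^ n \<in> ideal_power K (n * q)"
      using n m by (intro power_in_ideal_power; simp)+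
    then have yz: "y ^ (n * m) \<in> ideal_power K t" "z ^ (n * m) \<in> ideal_power K t"
      using ideal_power_antimono[of t "m * r" K] ideal_power_antimono[of t "n * q" K]
      by (auto simp: t_def mult.commute simp flip: power_mult)
    have "real m * (real n * \<epsilon>) \<le> real m * real r" "real n * (real m * \<epsilon>) \<le> real n * real q"
      using n m by (intro mult_left_mono; simp)+
    then have t: "real (n * m) * \<epsilon> \<le> real t" by (simp add: t_def min_def mult_ac)
    \<comment> \<open>\<open>M\<close> is so large that
      \<open>M * \<delta> \<le> (M - 1) * \<epsilon>\<close>: the slack between \<delta> and
      \<epsilon> pays for the one block lost in \<open>power_add_in_ideal_power\<close>.\<close>
    obtain M where M: "\<epsilon> / (\<epsilon> - \<delta>) < real M" using reals_Archimedean2 by blast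
    have M1: "M \<ge> 1" using M \<epsilon> False by (cases M) (auto simp: divide_simps)
    have "\<epsilon> < real M * (\<epsilon> - \<delta>)" using M \<epsilon> by (simp add: divide_simps)
    then have "real M * \<delta> \<le> real (M - 1) * \<epsilon>" using M1 by (simp add: of_nat_diff algebra_simps)
    then have "real (n * m) * (real M * \<delta>) \<le> real (n * m) * (real (M - 1) * \<epsilon>)"
      by (intro mult_left_mono) auto
    also have "\<dots> = real (M - 1) * (real (n * m) * \<epsilon>)" by simp
    also have "\<dots> \<le> real (M - 1) * real t" using t by (intro mult_left_mono) auto
    finally have "real (n * m * M) * \<delta> \<le> real ((M - 1) * t)" by (simp add: mult_ac)
    moreover have "(y + z) ^ (n * m * M) \<in> ideal_power K ((M - 1) * t)"
      using yz n m by (intro power_add_in_ideal_power) auto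
    moreover have "n * m * M \<ge> 1" using n m M1 by simp
    ultimately show ?thesis by blast
  qed
qed

lemma is_ideal_order_ideal: "is_ideal (order_ideal K \<gamma>)"
  unfolding is_ideal_iff
proof (intro conjI ballI allI)
  have "\<exists>n\<ge>1. \<exists>r. real n * \<delta> \<le> real r \<and> 0 ^ n \<in> ideal_power K r" for \<delta>
    using ideal_0[OF is_ideal_power]
    by (intro exI[of _ "1::nat"] conjI exI[of _ "nat \<lceil>\<delta>\<rceil>"]) (auto simp: real_nat_ceiling_ge)
  then show "0 \<in> order_ideal K \<gamma>" by (simp add: order_ideal_def)
next
  fix c x assume "x \<in> order_ideal K \<gamma>"
  then show "c * x \<in> order_ideal K \<gamma>"
    using order_ideal_mult[of c K 0 x \<gamma>] by (simp add: order_ideal_nonpos)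
qed (rule order_ideal_add)

lemma order_ideal_root:
  assumes "x ^ n \<in> order_ideal K \<gamma>" "n \<ge> 1"
  shows "x \<in> order_ideal K (\<gamma> / real n)"
  unfolding order_ideal_def
proof (intro CollectI allI impI)
  fix \<delta> :: real assume "\<delta> < \<gamma> / real n"
  then have "real n * \<delta> < \<gamma>" using assms(2) by (simp add: field_simps)
  then obtain m r where "m \<ge> 1" "real m * (real n * \<delta>) \<le> real r" "(x ^ n) ^ m \<in> ideal_power K r"
    using order_idealE[OF assms(1)] by metis
  then show "\<exists>N\<ge>1. \<exists>r. real N * \<delta> \<le> real r \<and> x ^ N \<in> ideal_power K r"
    using assms(2) by (intro exI[of _ "n * m"] conjI exI[of _ r]) (auto simp: mult_ac simp flip: power_mult)
qed

lemma ideal_power_subset_order_ideal: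
  assumes "J \<subseteq> order_ideal K \<gamma>"
  shows "ideal_power J n \<subseteq> order_ideal K (real n * \<gamma>)"
proof (induction n)
  case 0
  then show ?case by (simp add: order_ideal_nonpos)
next
  case (Suc n)
  have "x * y \<in> order_ideal K (real (Suc n) * \<gamma>)" if "x \<in> J" "y \<in> ideal_power J n" for x y
    using order_ideal_mult[of x K \<gamma> y "real n * \<gamma>"] that assms Suc by (auto simp: algebra_simps)
  then show ?case
    unfolding ideal_power.simps by (intro ideal_mult_least is_ideal_order_ideal)
qed

lemma power_in_order_ideal:
  "y \<in> order_ideal K \<gamma> \<Longrightarrow> y ^ n \<in> order_ideal K (real n * \<gamma>)"
proof (induction n)
  case (Suc n)
  then show ?case using order_ideal_mult[of y K \<gamma> "y ^ n" "real n * \<gamma>"] by (simp add: algebra_simps)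
qed (simp add: order_ideal_nonpos)

text \<open>The assumption on \<open>h\<close> bounds the loss in passing from a power back to the
  element. The inequality for \<gamma> is strict because membership in \<open>order_ideal\<close>
  speaks only of targets below \<gamma>, and the target used is \<open>r + h\<close>.\<close>

lemma order_ideal_subset_ideal_power:
  assumes h: "\<And>y n r. n \<ge> 1 \<Longrightarrow> y ^ n \<in> ideal_power K (n * (r + h)) \<Longrightarrow> y \<in> ideal_power K r"
    and \<gamma>: "real (r + h) < \<gamma>"
  shows "order_ideal K \<gamma> \<subseteq> ideal_power K r"
proof
  fix y assume "y \<in> order_ideal K \<gamma>"
  then obtain n q where n: "n \<ge> 1" "real n * real (r + h) \<le> real q" "y ^ n \<in> ideal_power K q"
    using order_idealE[OF _ \<gamma>] by metis
  then have "n * (r + h) \<le> q" by (metis of_nat_le_iff of_nat_mult)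
  then have "y ^ n \<in> ideal_power K (n * (r + h))" using n(3) ideal_power_antimono by blast
  then show "y \<in> ideal_power K r" using h n(1) by blast
qed

text \<open>If \<open>\<gamma>\<close> is irrational, the fractional parts of \<open>n * \<gamma>\<close> accumulate at \<open>0\<close> from above, whereas
  the ideals \<open>\<Oplus>\<^sub>r F\<^sub>r\<^sub>+\<^sub>\<beta> t\<^sup>r\<close> of the Rees algebra, with \<open>F\<close> the filtration by
  order, become stationary as \<open>\<beta>\<close> decreases to \<open>0\<close>; the shift by \<open>h + 1\<close> makes them lie in the
  Rees algebra.\<close>

theorem order_ideal_irrational_jump:
  fixes K :: "'a::comm_ring_1 set"
  assumes fg: "\<And>I::'a set. is_ideal I \<Longrightarrow> \<exists>G. finite G \<and> I = ideal_gen G"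
    and K: "is_ideal K"
    and h: "\<And>y n r. n \<ge> 1 \<Longrightarrow> y ^ n \<in> ideal_power K (n * (r + h)) \<Longrightarrow> y \<in> ideal_power K r"
    and J: "J \<subseteq> order_ideal K \<gamma>" and \<gamma>: "\<gamma> > 0" "\<gamma> \<notin> \<rat>"
  shows "\<exists>\<gamma>'>\<gamma>. J \<subseteq> order_ideal K \<gamma>'"
proof -
  let ?R = "rees_algebra (ideal_power K)"
  define F where "F \<beta> r = order_ideal K (real (r + h + 1) + \<beta>)" for \<beta> r
  \<comment> \<open>\<open>F \<beta> 0\<close> is in general not the whole ring;
    \<open>rees_algebra\<close> serves here only to prescribe where each coefficient lies. The
    result is an ideal of \<open>?R\<close> that increases with \<open>j\<close>, because the offset
    \<open>1 / (j + 1)\<close> shrinks.\<close>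
  define L where "L j = rees_algebra (F (1 / real (Suc j)))" for j
  have F: "is_ideal (F \<beta> r)" for \<beta> r by (simp add: F_def is_ideal_order_ideal)
  have Fsub: "F \<beta> r \<subseteq> ideal_power K r" if "\<beta> > 0" for \<beta> r
    unfolding F_def by (rule order_ideal_subset_ideal_power[OF h]) (use that in auto)
  \<comment> \<open>The factor \<open>c\<close> has order at least \<open>i\<close>, exactly what
    the passage from degree \<open>n - i\<close> to degree \<open>n\<close> demands.\<close>
  have Fmul: "c * x \<in> F \<beta> n" if "c \<in> ideal_power K i" "x \<in> F \<beta> (n - i)" "i \<le> n" for c x \<beta> i n
  proof -
    have "c \<in> order_ideal K (real i * 1)"
      using that(1) ideal_power_subset_order_ideal[OF subset_order_ideal_1[of K], of i] by blast
    moreover have "x \<in> order_ideal K (real (n - i + h + 1) + \<beta>)" using that(2) by (simp add: F_def)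
    moreover have "real i * 1 + (real (n - i + h + 1) + \<beta>) = real (n + h + 1) + \<beta>"
      using that(3) by (simp add: of_nat_diff)
    ultimately show ?thesis using order_ideal_mult unfolding F_def by metis
  qed
  have L: "ideal_of ?R (L j)" for j
    unfolding ideal_of_def
  proof (intro conjI ballI)
    show "L j \<subseteq> ?R" unfolding L_def rees_algebra_def using Fsub[of "1 / real (Suc j)"] by auto
    show "0 \<in> L j" using ideal_0[OF F] by (simp add: L_def rees_algebra_def)
  next
    fix p q assume "p \<in> L j" "q \<in> L j"
    then show "p - q \<in> L j" using is_ideal_diff[OF F] by (simp add: L_def rees_algebra_def)
  next
    fix p q assume "p \<in> ?R" "q \<in> L j"
    then show "p * q \<in> L j"
      unfolding L_def rees_algebra_def by (auto simp: coeff_mult intro!: ideal_sum[OF F] Fmul)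
  qed
  have inc: "L j \<subseteq> L (Suc j)" for j
  proof -
    have "F (1 / real (Suc j)) r \<subseteq> F (1 / real (Suc (Suc j))) r" for r
      unfolding F_def by (rule order_ideal_antimono) (simp add: field_simps)
    then show ?thesis unfolding L_def rees_algebra_def by auto
  qed
  have "noetherian_subring ?R" by (rule noetherian_rees_algebra[OF fg K])
  then obtain N where N: "\<And>j. j \<ge> N \<Longrightarrow> L j = L N"
    using noetherian_subringD[of ?R L] L inc by metis
  \<comment> \<open>The bound \<gamma> forces \<open>m \<ge> 1\<close> below; the other bound keeps
    \<open>(h + 1) * f\<close> inside the gap of length \<open>1 / (N + 1)\<close>.\<close>
  define \<epsilon> where "\<epsilon> = min \<gamma> (1 / (real (Suc N) * real (h + 1)))"
  have "\<epsilon> > 0" using \<gamma> by (simp add: \<epsilon>_def)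
  then obtain k where k: "k > 0" "\<bar>frac (real k * \<gamma>) - 0\<bar> < \<epsilon>"
    using Kronecker_approx_1_explicit[OF \<gamma>(2), of 0 \<epsilon>] by auto
  define f where "f = frac (real k * \<gamma>)"
  define m where "m = nat \<lfloor>real k * \<gamma>\<rfloor>"
  have kg: "real k * \<gamma> = real m + f"
    using \<gamma>(1) by (simp add: m_def f_def frac_def)
  have f0: "f > 0"
  proof -
    have "real k * \<gamma> \<notin> \<int>"
    proof
      assume "real k * \<gamma> \<in> \<int>"
      then have "real k * \<gamma> / real k \<in> \<rat>" using Ints_subset_Rats by (intro Rats_divide) auto
      then show False using \<gamma>(2) k(1) by simp
    qed
    then show ?thesis by (simp add: f_def frac_gt_0_iff)
  qed
  have f\<epsilon>: "f < \<epsilon>" using k(2) by (simp add: f_def frac_ge_0)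
  have m1: "m \<ge> 1"
  proof (rule ccontr)
    assume "\<not> m \<ge> 1"
    then have "real k * \<gamma> = f" using kg by simp
    moreover have "\<gamma> \<le> real k * \<gamma>" using k(1) \<gamma>(1) by simp
    ultimately show False using f\<epsilon> by (simp add: \<epsilon>_def)
  qed
  \<comment> \<open>Scaling by \<open>h + 1\<close> turns the integer part \<open>m\<close> into
    \<open>m * (h + 1) \<ge> h + 1\<close>, so removing the shift leaves a natural degree
    \<open>s\<close>.\<close>
  define n where "n = k * (h + 1)"
  define \<beta> where "\<beta> = real (h + 1) * f"
  define s where "s = m * (h + 1) - (h + 1)"
  have s: "s + h + 1 = m * (h + 1)" using m1 by (cases m) (simp_all add: s_def)
  have ng: "real n * \<gamma> = real (s + h + 1) + \<beta>"
  proof -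
    have "real n * \<gamma> = real (h + 1) * (real k * \<gamma>)" by (simp add: n_def algebra_simps)
    also have "\<dots> = real (s + h + 1) + \<beta>" unfolding kg s \<beta>_def by (simp add: algebra_simps)
    finally show ?thesis .
  qed
  have \<beta>: "0 < \<beta>" "\<beta> < 1 / real (Suc N)"
  proof -
    have "f < 1 / (real (Suc N) * real (h + 1))" using f\<epsilon> by (simp add: \<epsilon>_def)
    then have "f * (real (Suc N) * real (h + 1)) < 1" by (subst (asm) pos_less_divide_eq) simp_all
    then have "\<beta> * real (Suc N) < 1" by (simp only: \<beta>_def mult_ac)
    then show "\<beta> < 1 / real (Suc N)" by (subst pos_less_divide_eq) simp_all
    show "0 < \<beta>" using f0 unfolding \<beta>_def by (intro mult_pos_pos) auto
  qed
  \<comment> \<open>As \<beta> is positive, \<open>monom (x ^ n) s\<close> lies in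
    \<open>L j\<close> for some \<open>j \<ge> N\<close>. Stationarity moves it into
    \<open>L N\<close>, which raises the lower bound on the order of \<open>x ^ n\<close> from
    \<open>n * \<gamma>\<close> to \<open>n * \<gamma>'\<close>.\<close>
  obtain j where j: "j \<ge> N" "1 / real (Suc j) \<le> \<beta>"
  proof -
    obtain j where "1 / real (Suc j) < \<beta>" using nat_approx_posE[OF \<beta>(1)] .
    moreover have "1 / real (Suc (max j N)) \<le> 1 / real (Suc j)" by (simp add: field_simps)
    ultimately show ?thesis using that[of "max j N"] by linarith
  qed
  define \<gamma>' where "\<gamma>' = (real (s + h + 1) + 1 / real (Suc N)) / real n"
  have n: "n \<ge> 1" using k(1) by (simp add: n_def)
  have "\<gamma> * real n < real (s + h + 1) + 1 / real (Suc N)" using ng \<beta>(2) by (simp only: mult.commute)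
  then have "\<gamma>' > \<gamma>" unfolding \<gamma>'_def using n by (subst pos_less_divide_eq) simp_all
  moreover have "x \<in> order_ideal K \<gamma>'" if "x \<in> J" for x
  proof -
    have "x ^ n \<in> order_ideal K (real n * \<gamma>)" using power_in_order_ideal J that by blast
    also have "\<dots> \<subseteq> F (1 / real (Suc j)) s"
      unfolding F_def ng by (rule order_ideal_antimono) (use j in simp)
    finally have "monom (x ^ n) s \<in> L j"
      using ideal_0[OF F] by (simp add: L_def rees_algebra_def)
    then have "coeff (monom (x ^ n) s) s \<in> F (1 / real (Suc N)) s"
      unfolding N[OF j(1)] unfolding L_def rees_algebra_def by blast
    then show ?thesis
      using order_ideal_root[OF _ n] by (simp add: F_def \<gamma>'_def)
  qed
  ultimately show ?thesis by blast
qed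


section \<open>Resurgence\<close>

lemma filtration_antimono:
  assumes "ideal_filtration b" "m \<le> n" shows "b n \<subseteq> b m"
proof (rule lift_Suc_antimono_le[of b, OF _ assms(2)])
  fix n show "b (Suc n) \<subseteq> b n"
    using assms(1) by (cases n) (auto simp: ideal_filtration_def)
qed

lemma filtration_ideal: "ideal_filtration b \<Longrightarrow> is_ideal (b n)"
  by (cases n) (auto simp: ideal_filtration_def is_ideal_iff)

lemma filtration_veronese:
  assumes "ideal_filtration b" "l \<ge> 1" "standard_graded_veronese l b"
  shows "b (l * n) = ideal_power (b l) n"
proof (cases n)
  case 0
  then show ?thesis using assms(1) by (simp add: ideal_filtration_def)
next
  case (Suc m)
  have "\<forall>n\<ge>1. b (l * n) = ideal_power (b l) n"
    using assms standard_graded_veronese_iff[of b l] by (simp add: ideal_filtration_def)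
  then show ?thesis using Suc by (metis le_add1 plus_1_eq_Suc)
qed

lemma zero_in_integral_closure: "0 \<in> integral_closure I"
  unfolding integral_closure_def
  by (intro CollectI exI[of _ "1::nat"] conjI exI[of _ "\<lambda>_. 0"]) (simp_all add: ideal_0 is_ideal_power del: ideal_power.simps)

text \<open>The integral equation is \<open>X ^ n - y ^ n = 0\<close>.\<close>

lemma power_in_ideal_power_imp_integral:
  assumes "n \<ge> 1" "y ^ n \<in> ideal_power I n"
  shows "y \<in> integral_closure I"
proof -
  let ?c = "\<lambda>i. if i = n then - (y ^ n) else 0"
  have "(\<Sum>i=1..n. ?c i * y ^ (n - i)) = (\<Sum>i=1..n. if i = n then - (y ^ n) else 0)"
    by (intro sum.cong) auto
  also have "\<dots> = - (y ^ n)" using assms(1) by simp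
  finally have "y ^ n + (\<Sum>i=1..n. ?c i * y ^ (n - i)) = 0" by simp
  moreover have "\<forall>i\<in>{1..n}. ?c i \<in> ideal_power I i"
    using assms(2) by (auto intro: is_ideal_uminus ideal_0 is_ideal_power)
  ultimately show ?thesis
    unfolding integral_closure_def using assms(1)
    by (intro CollectI exI[of _ n] conjI exI[of _ ?c])
qed

text \<open>Let \<open>h\<close> be the largest degree of a module generator. In degree
  \<open>n + h\<close> a product of coefficients survives only if the generator contributes degree
  at most \<open>h\<close>; then the other factor lies in \<open>b i\<close> with
  \<open>i \<ge> n\<close>.\<close>

lemma integral_closure_shift:
  assumes b: "ideal_filtration b"
    and fg: "fin_gen_module (rees_algebra b) (rees_algebra (\<lambda>i. integral_closure (b i)))"
  obtains h where "\<And>n. integral_closure (b (n + h)) \<subseteq> b n"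
proof -
  obtain G where G: "finite G" "rees_algebra (\<lambda>i. integral_closure (b i)) =
      {\<Sum>g\<in>G. c g * g |c. \<forall>g\<in>G. c g \<in> rees_algebra b}"
    using fg unfolding fin_gen_module_def by blast
  define h where "h = Max (insert 0 (degree ` G))"
  have h: "degree g \<le> h" if "g \<in> G" for g unfolding h_def using G(1) that by (intro Max_ge) auto
  have "y \<in> b n" if y: "y \<in> integral_closure (b (n + h))" for y n
  proof -
    have "monom y (n + h) \<in> rees_algebra (\<lambda>i. integral_closure (b i))"
      using y zero_in_integral_closure by (auto simp: rees_algebra_def)
    then obtain c where c: "monom y (n + h) = (\<Sum>g\<in>G. c g * g)" "\<forall>g\<in>G. c g \<in> rees_algebra b"
      unfolding G(2) by blast
    have "y = coeff (\<Sum>g\<in>G. c g * g) (n + h)" by (simp flip: c(1))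
    also have "\<dots> = (\<Sum>g\<in>G. \<Sum>i\<le>n + h. coeff (c g) i * coeff g (n + h - i))"
      by (simp add: coeff_sum coeff_mult)
    also have "\<dots> \<in> b n"
    proof (intro ideal_sum filtration_ideal[OF b])
      fix g i assume g: "g \<in> G"
      show "coeff (c g) i * coeff g (n + h - i) \<in> b n"
      proof (cases "n \<le> i")
        case True
        have "coeff (c g) i \<in> b i" using c(2) g by (simp add: rees_algebra_def)
        then have "coeff (c g) i \<in> b n" using filtration_antimono[OF b True] by blast
        then show ?thesis
          using ideal_scale[OF filtration_ideal[OF b]] by (metis mult.commute)
      next
        case False
        then have "coeff g (n + h - i) = 0" using h[OF g] by (intro coeff_eq_0) linarith
        then show ?thesis using ideal_0[OF filtration_ideal[OF b]] by simp
      qed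
    qed
    finally show ?thesis .
  qed
  then show ?thesis using that[of h] by blast
qed

lemma real_less_Suc_div:
  assumes "k \<ge> 1" shows "real s < real k * (real (s div k) + 1)"
proof -
  have "s < k * (s div k + 1)" using assms dividend_less_times_div[of k s] by simp
  then have "real s < real (k * (s div k + 1))" by (simp only: of_nat_less_iff)
  then show ?thesis by (simp add: algebra_simps)
qed

section \<open>The supremum and when it is attained\<close>

lemma resurgence_upper:
  assumes "resurgence a b = ereal \<rho>" "s \<ge> 1" "r \<ge> 1" "\<not> a s \<subseteq> b r"
  shows "real s / real r \<le> \<rho>"
proof -
  have "ereal (real s / real r) \<le> resurgence a b"
    unfolding resurgence_def by (rule Sup_upper) (use assms(2-) in blast)
  then show ?thesis by (simp add: assms(1))
qed

lemma resurgence_lower: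
  assumes "resurgence a b = ereal \<rho>" "c < \<rho>"
  obtains s r where "s \<ge> 1" "r \<ge> 1" "\<not> a s \<subseteq> b r" "c < real s / real r"
proof -
  have "ereal c < Sup {ereal (real s / real r) |s r. s \<ge> 1 \<and> r \<ge> 1 \<and> \<not> a s \<subseteq> b r}"
    using assms unfolding resurgence_def[symmetric] by simp
  then obtain x where "x \<in> {ereal (real s / real r) |s r. s \<ge> 1 \<and> r \<ge> 1 \<and> \<not> a s \<subseteq> b r}" "ereal c < x"
    by (rule less_Sup_iff[THEN iffD1, THEN bexE])
  then have "\<exists>s r. s \<ge> 1 \<and> r \<ge> 1 \<and> \<not> a s \<subseteq> b r \<and> c < real s / real r" by force
  then show ?thesis using that by (elim exE conjE)
qed

text \<open>A finite resurgence that exceeds the slope of such a bound is attained.\<close>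

lemma resurgence_rational_if_linear_bound:
  assumes \<rho>: "resurgence a b = ereal \<rho>" and \<rho>': "\<rho>' < \<rho>"
    and bound: "\<And>s r. s \<ge> 1 \<Longrightarrow> r \<ge> 1 \<Longrightarrow> \<not> a s \<subseteq> b r \<Longrightarrow> real s \<le> \<rho>' * real r + D"
  shows "\<rho> \<in> \<rat>"
proof -
  obtain c where c: "\<rho>' < c" "c < \<rho>" using dense[OF \<rho>'] by blast
  define B where "B = {(s, r). s \<ge> 1 \<and> r \<ge> 1 \<and> \<not> a s \<subseteq> b r \<and> c < real s / real r}"
  define f where "f = (\<lambda>(s, r). real s / real r)"
  \<comment> \<open>A ratio above \<open>c\<close> turns the linear bound into
    \<open>(c - \<rho>') * r < \<bar>D\<bar>\<close>, which bounds \<open>r\<close>; then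
    \<open>s \<le> \<rho> * r\<close> bounds \<open>s\<close>.\<close>
  have "B \<subseteq> {..nat \<lceil>\<bar>\<rho>\<bar> * (\<bar>D\<bar> / (c - \<rho>'))\<rceil>} \<times> {..nat \<lceil>\<bar>D\<bar> / (c - \<rho>')\<rceil>}"
  proof clarify
    fix s r assume "(s, r) \<in> B"
    then have *: "s \<ge> 1" "r \<ge> 1" "\<not> a s \<subseteq> b r" "c < real s / real r" by (auto simp: B_def)
    have "c * real r < real s" using *(2,4) by (simp add: field_simps)
    then have "(c - \<rho>') * real r < \<bar>D\<bar>" using bound[OF *(1-3)] by (simp add: algebra_simps)
    then have r: "real r \<le> \<bar>D\<bar> / (c - \<rho>')" using c by (simp add: field_simps)
    have "real s \<le> \<rho> * real r" using resurgence_upper[OF \<rho> *(1-3)] *(2) by (simp add: field_simps)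
    also have "\<dots> \<le> \<bar>\<rho>\<bar> * real r" by (intro mult_right_mono) auto
    also have "\<dots> \<le> \<bar>\<rho>\<bar> * (\<bar>D\<bar> / (c - \<rho>'))" using r by (intro mult_left_mono) auto
    finally have "real s \<le> \<bar>\<rho>\<bar> * (\<bar>D\<bar> / (c - \<rho>'))" .
    then have "real s \<le> real (nat \<lceil>\<bar>\<rho>\<bar> * (\<bar>D\<bar> / (c - \<rho>'))\<rceil>)"
      using real_nat_ceiling_ge order_trans by blast
    moreover have "real r \<le> real (nat \<lceil>\<bar>D\<bar> / (c - \<rho>')\<rceil>)"
      using r real_nat_ceiling_ge order_trans by blast
    ultimately show "s \<in> {..nat \<lceil>\<bar>\<rho>\<bar> * (\<bar>D\<bar> / (c - \<rho>'))\<rceil>} \<and> r \<in> {..nat \<lceil>\<bar>D\<bar> / (c - \<rho>')\<rceil>}"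
      unfolding of_nat_le_iff by simp
  qed
  then have fin: "finite (f ` B)" by (meson finite_SigmaI finite_atMost finite_imageI finite_subset)
  obtain s0 r0 where "s0 \<ge> 1" "r0 \<ge> 1" "\<not> a s0 \<subseteq> b r0" "c < real s0 / real r0"
    using resurgence_lower[OF \<rho> c(2)] .
  then have ne: "f ` B \<noteq> {}" by (auto simp: B_def)
  have "Max (f ` B) \<in> f ` B" using fin ne by simp
  then obtain s r where sr: "(s, r) \<in> B" "Max (f ` B) = real s / real r" by (auto simp: f_def)
  have "Max (f ` B) \<le> \<rho>" using sr resurgence_upper[OF \<rho>, of s r] by (auto simp: B_def)
  \<comment> \<open>A failing pair that beats the maximum would also exceed \<open>c\<close> and
    hence belong to \<open>B\<close>.\<close>
  moreover have "\<not> Max (f ` B) < \<rho>"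
  proof
    assume "Max (f ` B) < \<rho>"
    then obtain s' r' where s': "s' \<ge> 1" "r' \<ge> 1" "\<not> a s' \<subseteq> b r'" "Max (f ` B) < real s' / real r'"
      using resurgence_lower[OF \<rho>] by metis
    moreover have "c < Max (f ` B)" using sr by (simp add: B_def)
    ultimately have "(s', r') \<in> B" by (simp add: B_def)
    then have "f (s', r') \<le> Max (f ` B)" using fin by (intro Max_ge) auto
    then show False using s'(4) by (simp add: f_def)
  qed
  ultimately have "\<rho> = real s / real r" using sr(2) by simp
  then show ?thesis by simp
qed

theorem resurgence_rational:
  fixes a b :: "nat \<Rightarrow> 'a::comm_ring_1 set"
  assumes fg: "\<And>I::'a set. is_ideal I \<Longrightarrow> \<exists>G. finite G \<and> I = ideal_gen G"
    and a: "ideal_filtration a" "k \<ge> 1" "standard_graded_veronese k a"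
    and b: "ideal_filtration b" "l \<ge> 1" "standard_graded_veronese l b"
    and cl: "fin_gen_module (rees_algebra b) (rees_algebra (\<lambda>i. integral_closure (b i)))"
    and \<rho>: "resurgence a b = ereal \<rho>"
  shows "\<rho> \<in> \<rat>"
proof (rule ccontr)
  assume irr: "\<rho> \<notin> \<rat>"
  let ?J = "a k" and ?K = "b l"
  note aJ = filtration_veronese[OF a] and bK = filtration_veronese[OF b]
  obtain h where h: "\<And>n. integral_closure (b (n + h)) \<subseteq> b n"
    using integral_closure_shift[OF b(1) cl] by blast
  \<comment> \<open>The premise makes \<open>y\<close> integral over \<open>b (l * (r + h))\<close>.
    Lowering that index by \<open>h\<close> leaves it at least \<open>l * r\<close>, since
    \<open>l \<ge> 1\<close>.\<close>
  have hK: "y \<in> ideal_power ?K r" if "n \<ge> 1" "y ^ n \<in> ideal_power ?K (n * (r + h))" for y n r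
  proof -
    have "y ^ n \<in> ideal_power (b (l * (r + h))) n"
      using that(2) ideal_power_power_subset[of ?K n "r + h"] bK by auto
    then have "y \<in> integral_closure (b (l * (r + h)))"
      using that(1) by (rule power_in_ideal_power_imp_integral[rotated])
    also have "l * (r + h) = (l * r + (l - 1) * h) + h"
    proof -
      obtain l' where "l = Suc l'" using b(2) by (cases l) auto
      then show ?thesis by (simp add: algebra_simps)
    qed
    also have "integral_closure (b (l * r + (l - 1) * h + h)) \<subseteq> b (l * r + (l - 1) * h)"
      by (rule h)
    also have "\<dots> \<subseteq> b (l * r)" by (rule filtration_antimono[OF b(1)]) simp
    finally show ?thesis by (simp add: bK)
  qed
  \<comment> \<open>A finite supremum means that some containment fails, and every ratio is
    positive.\<close>
  have "\<rho> > 0"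
  proof -
    obtain s r where sr: "s \<ge> 1" "r \<ge> 1" "\<not> a s \<subseteq> b r" "\<rho> - 1 < real s / real r"
      using resurgence_lower[OF \<rho>, of "\<rho> - 1"] by auto
    then have "0 < real s / real r" by simp
    also have "\<dots> \<le> \<rho>" using resurgence_upper[OF \<rho> sr(1-3)] .
    finally show ?thesis .
  qed
  \<comment> \<open>For positive \<open>n\<close> and \<open>r\<close>, the condition
    \<open>k * n / (l * r) > \<rho>\<close> reads \<open>r < n * \<gamma>\<close>, and it forces
    \<open>a (k * n) \<subseteq> b (l * r)\<close>, which is a containment between the
    \<open>n\<close>-th power of \<open>?J\<close> and the \<open>r\<close>-th power of
    \<open>?K\<close>.\<close>
  define \<gamma> where "\<gamma> = real k / (real l * \<rho>)"
  have "\<gamma> > 0" using a(2) b(2) \<open>\<rho> > 0\<close> by (simp add: \<gamma>_def)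
  have \<rho>\<gamma>: "\<rho> = real k / (real l * \<gamma>)" using a(2) b(2) \<open>\<rho> > 0\<close> by (simp add: \<gamma>_def)
  have "\<gamma> \<notin> \<rat>" using irr \<rho>\<gamma> by (metis Rats_divide Rats_mult Rats_of_nat)
  have JK: "?J \<subseteq> order_ideal ?K \<gamma>"
    unfolding order_ideal_def
  proof (intro subsetI CollectI allI impI)
    fix x \<delta> assume x: "x \<in> ?J" and \<delta>: "\<delta> < \<gamma>"
    \<comment> \<open>\<open>n * (\<gamma> - \<delta>) > 1\<close> leaves room for a natural number
      \<open>r\<close> with \<open>n * \<delta> \<le> r < n * \<gamma>\<close>.\<close>
    obtain n where n: "1 / (\<gamma> - \<delta>) < real n" using reals_Archimedean2 by blast
    have n1: "n \<ge> 1" using n \<delta> by (cases n) (auto simp: divide_simps)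
    have n\<gamma>: "real n * \<delta> + 1 < real n * \<gamma>" using n \<delta> by (simp add: field_simps)
    define r where "r = nat \<lceil>real n * \<delta>\<rceil>"
    have "real n * \<delta> \<le> real r" by (simp add: r_def real_nat_ceiling_ge)
    moreover have r: "real r < real n * \<gamma>"
    proof (cases "real n * \<delta> \<le> 0")
      case True
      then have "r = 0" by (simp add: r_def ceiling_le_zero)
      then show ?thesis using n1 \<open>\<gamma> > 0\<close> by simp
    next
      case False
      then have "real r = of_int \<lceil>real n * \<delta>\<rceil>" by (simp add: r_def)
      then show ?thesis using n\<gamma> ceiling_correct[of "real n * \<delta>"] by linarith
    qed
    moreover have "x ^ n \<in> ideal_power ?K r"
    \<comment> \<open>The resurgence ranges over positive indices only; for \<open>r = 0\<close> the
      power is the whole ring.\<close>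
    proof (cases "r = 0")
      case False
      have "a (k * n) \<subseteq> b (l * r)"
      proof (rule ccontr)
        assume "\<not> a (k * n) \<subseteq> b (l * r)"
        then have "real (k * n) / real (l * r) \<le> \<rho>"
          using a(2) b(2) n1 False by (intro resurgence_upper[OF \<rho>]) auto
        then have "real n * \<gamma> \<le> real r"
          using b(2) False \<open>\<rho> > 0\<close> by (simp add: \<gamma>_def field_simps)
        then show False using r by simp
      qed
      moreover have "x ^ 1 \<in> ideal_power ?J 1" using x aJ[of 1] by simp
      then have "x ^ n \<in> ideal_power ?J n" using power_in_ideal_power[of x ?J 1 n] by simp
      ultimately show ?thesis unfolding aJ bK by blast
    qed simp
    ultimately show "\<exists>n\<ge>1. \<exists>r. real n * \<delta> \<le> real r \<and> x ^ n \<in> ideal_power ?K r"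
      using n1 by blast
  qed
  have "\<exists>\<gamma>'>\<gamma>. ?J \<subseteq> order_ideal ?K \<gamma>'"
    by (rule order_ideal_irrational_jump[where h = h])
      (fact fg filtration_ideal[OF b(1)] hK JK \<open>\<gamma> > 0\<close> \<open>\<gamma> \<notin> \<rat>\<close>)+
  then obtain \<gamma>' where \<gamma>': "\<gamma>' > \<gamma>" "?J \<subseteq> order_ideal ?K \<gamma>'" by blast
  have "\<gamma>' > 0" using \<gamma>' \<open>\<gamma> > 0\<close> by simp
  define \<rho>' where "\<rho>' = real k / (real l * \<gamma>')"
  have "\<rho>' < \<rho>"
    unfolding \<rho>\<gamma> \<rho>'_def using \<gamma>'(1) \<open>\<gamma> > 0\<close> a(2) b(2) by (intro divide_strict_left_mono) auto
  have "real s \<le> \<rho>' * real r + (real k + real k * (1 + real h) / \<gamma>')"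
    if sr: "\<not> a s \<subseteq> b r" for s r
  proof -
    \<comment> \<open>Rounding \<open>s\<close> down to a multiple of \<open>k\<close> and
      \<open>r\<close> up to a multiple of \<open>l\<close> keeps the containment failing, now
      between powers of \<open>?J\<close> and \<open>?K\<close>. The constant term of the bound
      collects the rounding errors and the loss \<open>h\<close>.\<close>
    define n where "n = s div k"
    define q where "q = r div l + 1"
    have "real n * \<gamma>' \<le> real (q + h)"
    proof (rule ccontr)
      assume "\<not> real n * \<gamma>' \<le> real (q + h)"
      then have "order_ideal ?K (real n * \<gamma>') \<subseteq> ideal_power ?K q"
        by (intro order_ideal_subset_ideal_power[OF hK]) auto
      then have "a (k * n) \<subseteq> b (l * q)"
        using ideal_power_subset_order_ideal[OF \<gamma>'(2), of n] by (simp add: aJ bK)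
      moreover have "a s \<subseteq> a (k * n)"
        by (rule filtration_antimono[OF a(1)]) (simp add: n_def)
      moreover have "b (l * q) \<subseteq> b r"
        by (rule filtration_antimono[OF b(1)])
          (use b(2) dividend_less_times_div[of l r] in \<open>simp add: q_def\<close>)
      ultimately show False using sr by blast
    qed
    also have "real (q + h) \<le> real r / real l + 1 + real h"
      using of_nat_div_le_of_nat[of r l, where ?'a = real] by (simp add: q_def)
    finally have "real n \<le> (real r / real l + 1 + real h) / \<gamma>'"
      using \<open>\<gamma>' > 0\<close> by (simp add: field_simps)
    then have "real k * (real n + 1) \<le> real k * ((real r / real l + 1 + real h) / \<gamma>' + 1)"
      by (intro mult_left_mono) auto
    also have "\<dots> = \<rho>' * real r + (real k + real k * (1 + real h) / \<gamma>')"
      using \<open>\<gamma>' > 0\<close> b(2) by (simp add: \<rho>'_def field_simps)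
    finally show ?thesis using real_less_Suc_div[OF a(2), of s] by (simp add: n_def)
  qed
  then show False using resurgence_rational_if_linear_bound[OF \<rho> \<open>\<rho>' < \<rho>\<close>] irr by blast
qed

theorem corollary6p11:
  fixes M :: "'a::idom set"
    and a b :: "nat \<Rightarrow> 'a set"
    and k l :: nat
  assumes "analytically_unramified_local M"
    and "ideal_filtration a" and "\<forall>i\<ge>1. a i \<noteq> {0}"
    and "ideal_filtration b" and "\<forall>i\<ge>1. b i \<noteq> {0}"
    and "k \<ge> 1" and "standard_graded_veronese k a"
    and "l \<ge> 1" and "standard_graded_veronese l b"
    and "fin_gen_module (rees_algebra b) (rees_algebra (\<lambda>i. integral_closure (b i)))"
    and "\<exists>I. is_ideal I \<and> ideal_equivalent b I"
  shows "resurgence a b = \<infinity> \<or> resurgence a b = -\<infinity> \<or>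
         (\<exists>q::rat. resurgence a b = ereal (of_rat q))"
proof (cases "resurgence a b")
  case (real \<rho>)
  have "\<exists>G. finite G \<and> I = ideal_gen G" if "is_ideal I" for I :: "'a set"
    using assms(1) that by (simp add: analytically_unramified_local_def noetherian_local_def)
  then have "\<rho> \<in> \<rat>" using resurgence_rational assms(2,4,6-10) real by blast
  then show ?thesis using real by (auto elim: Rats_cases)
qed auto

end
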